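(* Let $p$ be a prime. For a non-abelian powerfully nilpotent $p$-group $G$, write $D(G)=G/Z(G)^{p}$ for its direct descendant in the ancestry tree. First let $G=\langle a,b\mid a^{p^{n}}=1,\ b^{p^{m}}=1,\ [a,b]=a^{p^{r}}\rangle$ where $m\ge n-r$ and $2\le r\le n-1$. Then: (a) if $m>n-r$, then $D(G)\cong\langle a,b\mid a^{p^{n-r+1}}=1,\ b^{p^{n-r+1}}=1,\ [a,b]=a^{p^{r}}\rangle$; (b) if $m=n-r$, then $D(G)\cong\langle a,b\mid a^{p^{n-r+1}}=1,\ b^{p^{n-r}}=1,\ [a,b]=a^{p^{r}}\rangle$. In both cases $D(G)$ is abelian if and only if $r\ge n-r+1$. Next let $G=\langle a,b\mid a^{p^{n}}=1,\ b^{p^{m}}=a^{p^{l}},\ [a,b]=a^{p^{r}}\rangle$ where $2\le r<l\le n-1$ and $n-r\le l<m$. Then: (c) if $n-r<l$, then $D(G)\cong\langle a,b\mid a^{p^{n-r+1}}=1,\ b^{p^{n-r+1}}=1,\ [a,b]=a^{p^{r}}\rangle$, and $D(G)$ is abelian if and only if $r\ge n-r+1$; (d) if $n-r=l$, then $D(G)\cong\langle a,b\mid a^{p^{n-r}}=1,\ b^{p^{n-r+1}}=1,\ [a,b]=a^{p^{r}}\rangle$, and $D(G)$ is not abelian.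
   Context: All $p$-groups are finite, and all parameters are positive integers. $[x,y]=x^{-1}y^{-1}xy$. For a group $H$ and a positive integer $k$, $H^{k}$ denotes the subgroup generated by all $k$-th powers of elements of $H$; thus $Z(G)^{p}$ is the subgroup of $p$-th powers of the center of $G$. A finite $p$-group $G$ is powerful if $[G,G]\le G^{p}$ when $p$ is odd, and $[G,G]\le G^{4}$ when $p=2$. A powerful $p$-group $G$ is powerfully nilpotent if it has an ascending chain of subgroups $\{1\}=H_{0}\le H_{1}\le\cdots\le H_{n}=G$ such that $[H_{i},G]\le H_{i-1}^{p}$ for $i=1,\ldots,n$. The ancestry tree (for a fixed prime $p$) has as vertices the isomorphism classes of powerfully nilpotent $p$-groups, with a directed edge $H\to G$ if and only if $H\cong G/Z(G)^{p}$ and $G$ is not abelian; then $H$ is called a direct descendant of $G$ and $G$ a direct ancestor of $H$. The two presentations in the statement (with the stated parameter ranges) define non-abelian powerfully nilpotent $p$-groups of rank $2$ and order $p^{n+m}$. *)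

theory Defs
  imports "HOL-Algebra.Generated_Groups" "HOL-Computational_Algebra.Primes"
begin

subsection \<open>Group presentations\<close>

text \<open>
  A word is a list of letters; \<open>(x, True)\<close> stands for the generator \<open>x\<close> and \<open>(x, False)\<close> for its
  formal inverse. A set of relations is a set of pairs \<open>(u, v)\<close> of words, read as \<open>u = v\<close>.
  The group presented by \<open>R\<close> on the generators \<open>UNIV :: 'a set\<close> consists of all words modulo the
  least congruence that contains \<open>R\<close> and makes formal inverses cancel.
\<close>

type_synonym 'a word = "('a \<times> bool) list"

definition inv_word :: "'a word \<Rightarrow> 'a word" where
  "inv_word w = rev (map (\<lambda>(x, e). (x, \<not> e)) w)"

definition commutator_word :: "'a word \<Rightarrow> 'a word \<Rightarrow> 'a word" where
  "commutator_word u v = inv_word u @ inv_word v @ u @ v"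

inductive word_cong :: "('a word \<times> 'a word) set \<Rightarrow> 'a word \<Rightarrow> 'a word \<Rightarrow> bool"
  for R :: "('a word \<times> 'a word) set" where
  relation: "(u, v) \<in> R \<Longrightarrow> word_cong R u v"
| cancel: "word_cong R [(x, e), (x, \<not> e)] []"
| refl: "word_cong R u u"
| sym: "word_cong R u v \<Longrightarrow> word_cong R v u"
| trans: "word_cong R u v \<Longrightarrow> word_cong R v w \<Longrightarrow> word_cong R u w"
| append: "word_cong R u u' \<Longrightarrow> word_cong R v v' \<Longrightarrow> word_cong R (u @ v) (u' @ v')"

definition word_class :: "('a word \<times> 'a word) set \<Rightarrow> 'a word \<Rightarrow> 'a word set" where
  "word_class R w = {v. word_cong R w v}"

definition presented_group :: "('a word \<times> 'a word) set \<Rightarrow> 'a word set monoid" where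
  "presented_group R =
     \<lparr>carrier = range (word_class R),
      monoid.mult = (\<lambda>X Y. \<Union>u\<in>X. \<Union>v\<in>Y. word_class R (u @ v)),
      one = word_class R []\<rparr>"

lemma word_class_eq_iff: "word_class R u = word_class R v \<longleftrightarrow> word_cong R u v"
proof
  assume "word_class R u = word_class R v"
  moreover have "v \<in> word_class R v" by (simp add: word_class_def word_cong.refl)
  ultimately have "v \<in> word_class R u" by simp
  then show "word_cong R u v" by (simp add: word_class_def)
next
  assume *: "word_cong R u v"
  show "word_class R u = word_class R v"
    unfolding word_class_def
    using word_cong.trans[OF *] word_cong.trans[OF word_cong.sym[OF *]] by (intro Collect_cong iffI)
qed

lemma mult_word_class:
  "word_class R u \<otimes>\<^bsub>presented_group R\<^esub> word_class R v = word_class R (u @ v)"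
proof -
  have "word_class R (u' @ v') = word_class R (u @ v)"
    if u': "u' \<in> word_class R u" and v': "v' \<in> word_class R v" for u' v'
  proof -
    have "word_cong R u u'" "word_cong R v v'"
      using u' v' by (simp_all add: word_class_def)
    then have "word_cong R (u @ v) (u' @ v')" by (rule word_cong.append)
    then show ?thesis by (simp only: word_class_eq_iff word_cong.sym)
  qed
  then have "(\<Union>u'\<in>word_class R u. \<Union>v'\<in>word_class R v. word_class R (u' @ v'))
      = (\<Union>u'\<in>word_class R u. \<Union>v'\<in>word_class R v. word_class R (u @ v))"
    by (intro SUP_cong HOL.refl)
  moreover have "u \<in> word_class R u" "v \<in> word_class R v"
    by (simp_all add: word_class_def word_cong.refl)
  ultimately show ?thesis
    by (auto simp: presented_group_def)
qed

lemma word_cong_inv_word: "word_cong R (inv_word w @ w) []"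
proof (induction w)
  case Nil
  show ?case by (simp add: inv_word_def word_cong.refl)
next
  case (Cons l w)
  obtain x e where l: "l = (x, e)" by (cases l)
  have "word_cong R ([(x, \<not> e), (x, e)] @ w) ([] @ w)"
    using word_cong.append[OF word_cong.cancel[of R x "\<not> e"] word_cong.refl] by simp
  from word_cong.append[OF word_cong.refl[of R "inv_word w"] this]
  have "word_cong R (inv_word (l # w) @ l # w) (inv_word w @ w)"
    by (simp add: inv_word_def l)
  with Cons.IH show ?case by (rule word_cong.trans[rotated])
qed

lemma group_presented_group: "group (presented_group R)"
proof (rule groupI)
  fix X assume "X \<in> carrier (presented_group R)"
  then obtain w where w: "X = word_class R w" by (auto simp: presented_group_def)
  have "word_class R (inv_word w) \<otimes>\<^bsub>presented_group R\<^esub> X = \<one>\<^bsub>presented_group R\<^esub>"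
    unfolding w mult_word_class
    by (simp add: presented_group_def word_class_eq_iff word_cong_inv_word)
  moreover have "word_class R (inv_word w) \<in> carrier (presented_group R)"
    by (simp add: presented_group_def)
  ultimately show "\<exists>Y\<in>carrier (presented_group R).
      Y \<otimes>\<^bsub>presented_group R\<^esub> X = \<one>\<^bsub>presented_group R\<^esub>" by blast
next
  have carr: "carrier (presented_group R) = range (word_class R)"
    and one: "\<one>\<^bsub>presented_group R\<^esub> = word_class R []"
    by (simp_all add: presented_group_def)
  show "\<one>\<^bsub>presented_group R\<^esub> \<in> carrier (presented_group R)" by (simp add: carr one)
  fix X Y assume "X \<in> carrier (presented_group R)" "Y \<in> carrier (presented_group R)"
  then show "X \<otimes>\<^bsub>presented_group R\<^esub> Y \<in> carrier (presented_group R)"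
    by (auto simp: carr mult_word_class)
next
  have carr: "carrier (presented_group R) = range (word_class R)"
    and one: "\<one>\<^bsub>presented_group R\<^esub> = word_class R []"
    by (simp_all add: presented_group_def)
  fix X assume X: "X \<in> carrier (presented_group R)"
  then show "\<one>\<^bsub>presented_group R\<^esub> \<otimes>\<^bsub>presented_group R\<^esub> X = X"
    by (auto simp: carr one mult_word_class)
  fix Y Z assume "Y \<in> carrier (presented_group R)" "Z \<in> carrier (presented_group R)"
  with X show "X \<otimes>\<^bsub>presented_group R\<^esub> Y \<otimes>\<^bsub>presented_group R\<^esub> Z
      = X \<otimes>\<^bsub>presented_group R\<^esub> (Y \<otimes>\<^bsub>presented_group R\<^esub> Z)"
    by (auto simp: carr mult_word_class)
qed

subsection \<open>Powerfully nilpotent groups\<close>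

definition group_commutator :: "('a, 'b) monoid_scheme \<Rightarrow> 'a \<Rightarrow> 'a \<Rightarrow> 'a" where
  "group_commutator G x y = inv\<^bsub>G\<^esub> x \<otimes>\<^bsub>G\<^esub> inv\<^bsub>G\<^esub> y \<otimes>\<^bsub>G\<^esub> x \<otimes>\<^bsub>G\<^esub> y"

definition commutator_subgroup :: "('a, 'b) monoid_scheme \<Rightarrow> 'a set \<Rightarrow> 'a set \<Rightarrow> 'a set" where
  "commutator_subgroup G H K = generate G {group_commutator G x y |x y. x \<in> H \<and> y \<in> K}"

definition power_subgroup :: "('a, 'b) monoid_scheme \<Rightarrow> 'a set \<Rightarrow> nat \<Rightarrow> 'a set" where
  "power_subgroup G H k = generate G ((\<lambda>x. x [^]\<^bsub>G\<^esub> k) ` H)"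

definition group_center :: "('a, 'b) monoid_scheme \<Rightarrow> 'a set" where
  "group_center G = {z \<in> carrier G. \<forall>x\<in>carrier G. z \<otimes>\<^bsub>G\<^esub> x = x \<otimes>\<^bsub>G\<^esub> z}"

definition finite_p_group :: "nat \<Rightarrow> ('a, 'b) monoid_scheme \<Rightarrow> bool" where
  "finite_p_group p G \<longleftrightarrow> prime p \<and> group G \<and> finite (carrier G) \<and> (\<exists>k. order G = p ^ k)"

definition powerful :: "nat \<Rightarrow> ('a, 'b) monoid_scheme \<Rightarrow> bool" where
  "powerful p G \<longleftrightarrow> finite_p_group p G \<and>
     commutator_subgroup G (carrier G) (carrier G)
       \<subseteq> power_subgroup G (carrier G) (if p = 2 then 4 else p)"

definition powerfully_nilpotent :: "nat \<Rightarrow> ('a, 'b) monoid_scheme \<Rightarrow> bool" where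
  "powerfully_nilpotent p G \<longleftrightarrow> powerful p G \<and>
     (\<exists>(n::nat) H. (\<forall>i\<le>n. subgroup (H i) G) \<and> H 0 = {\<one>\<^bsub>G\<^esub>} \<and> H n = carrier G \<and>
        (\<forall>i\<in>{1..n}. H (i - 1) \<subseteq> H i \<and>
           commutator_subgroup G (H i) (carrier G) \<subseteq> power_subgroup G (H (i - 1)) p))"

subsection \<open>The ancestry tree\<close>

definition descendant :: "nat \<Rightarrow> ('a, 'b) monoid_scheme \<Rightarrow> 'a set monoid" where
  "descendant p G = G Mod power_subgroup G (group_center G) p"

text \<open>
  The edge from \<open>H\<close> to \<open>G\<close>, stated for representatives of the isomorphism classes that are the
  vertices.
\<close>

definition direct_descendant ::
  "nat \<Rightarrow> ('a, 'b) monoid_scheme \<Rightarrow> ('c, 'd) monoid_scheme \<Rightarrow> bool" where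
  "direct_descendant p H G \<longleftrightarrow>
     powerfully_nilpotent p H \<and> powerfully_nilpotent p G \<and>
     H \<cong> descendant p G \<and> \<not> comm_group G"

subsection \<open>The two families of presentations\<close>

datatype gen = Gen_a | Gen_b

definition gen_power :: "gen \<Rightarrow> nat \<Rightarrow> gen word" where
  "gen_power x k = replicate k (x, True)"

definition split_pres :: "nat \<Rightarrow> nat \<Rightarrow> nat \<Rightarrow> nat \<Rightarrow> gen word set monoid" where
  "split_pres p n m r = presented_group
     {(gen_power Gen_a (p ^ n), []),
      (gen_power Gen_b (p ^ m), []),
      (commutator_word (gen_power Gen_a 1) (gen_power Gen_b 1), gen_power Gen_a (p ^ r))}"

definition nonsplit_pres :: "nat \<Rightarrow> nat \<Rightarrow> nat \<Rightarrow> nat \<Rightarrow> nat \<Rightarrow> gen word set monoid" where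
  "nonsplit_pres p n m l r = presented_group
     {(gen_power Gen_a (p ^ n), []),
      (gen_power Gen_b (p ^ m), gen_power Gen_a (p ^ l)),
      (commutator_word (gen_power Gen_a 1) (gen_power Gen_b 1), gen_power Gen_a (p ^ r))}"

end

(*
Both presentations give metacyclic groups: each element is b^j a^i, and b acts on <a> as the power
u = 1 + p^r. If a has order exactly p^n, then b^j a^i is central iff i p^r and u^j - 1 vanish modulo
p^n, i.e. iff p^(n-r) divides i and j (here r >= 2 covers p = 2). So Z(G)^p is generated by
a^(p^(n-r+1)) and b^(p^(n-r+1)), and adjoining these two relators to the presentation of G leaves a
split presentation. That a has order p^n is seen in an affine action on Z/p^(n+k): a is translation
by p^k and b is x |-> u x + c. The split case takes k = c = 0; the non-split case takes k = m - l and
solves b^(p^m) = a^(p^l) for c, which is possible because 1 + u + ... + u^(p^m - 1) is p^m times a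
unit. The subgroups <a^(p^(n-i))>, followed by G, form the chain for powerful nilpotence.
*)
theory Submission
  imports Defs "HOL-Algebra.Multiplicative_Group" "HOL-Number_Theory.Cong"
begin

subsection \<open>Valuations of powers of \<open>1 + p^r\<close>\<close>

text \<open>The four cases have one source. Put s = n - r + 1, and read the split family as l = n.
  The descendant then satisfies a^(p^s) = b^(p^s) = 1 and b^(p^m) = a^(p^l). If l and m are both at
  least s, the last relation is void. If exactly one of them is s - 1, the other side of that
  relation has become trivial, and the generator on the short side loses one more factor p. The
  order of \<open>a\<close> is the one quantity that must be exact: centrality and commutativity are
  equations between powers of \<open>a\<close>, and its order turns them into divisibility.
  Manipulating words only bounds this order from above. Nothing in a presentation excludes collapse,
  so the lower bound needs a model.\<close>

lemma one_plus_power_expansion: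
  fixes y :: int
  obtains w where "(1 + y) ^ k = 1 + int k * y + y\<^sup>2 * w"
proof -
  have "\<exists>w. (1 + y) ^ k = 1 + int k * y + y\<^sup>2 * w"
  proof (induction k)
    case 0
    show ?case by (intro exI[of _ 0]) simp
  next
    case (Suc k)
    then obtain w where "(1 + y) ^ k = 1 + int k * y + y\<^sup>2 * w" by blast
    then have "(1 + y) ^ Suc k = 1 + int (Suc k) * y + y\<^sup>2 * (int k + (1 + y) * w)"
      by (simp add: algebra_simps power2_eq_square)
    then show ?case by blast
  qed
  with that show thesis by blast
qed

text \<open>Lifting the exponent. With k = r + m, the square of y = p^k t is divisible by p^(2k),
  and 2k \<ge> k + 2 because r \<ge> 2. So (1 + y)^p agrees with 1 + p y modulo p^(k+2), and the
  cofactor \<open>t\<close> changes only by a multiple of p. The same estimate serves p = 2.\<close>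

lemma one_plus_prime_power_power:
  fixes p r m :: nat
  assumes "prime p" "2 \<le> r"
  obtains t where "(1 + int p ^ r) ^ (p ^ m) = 1 + int p ^ (r + m) * t" "\<not> int p dvd t"
proof -
  have "\<exists>t. (1 + int p ^ r) ^ (p ^ m) = 1 + int p ^ (r + m) * t \<and> \<not> int p dvd t"
  proof (induction m)
    case 0
    show ?case using assms by (intro exI[of _ 1]) (simp add: prime_nat_iff)
  next
    case (Suc m)
    then obtain t where t: "(1 + int p ^ r) ^ (p ^ m) = 1 + int p ^ (r + m) * t"
      and nt: "\<not> int p dvd t" by blast
    define y where "y = int p ^ (r + m) * t"
    obtain w where w: "(1 + y) ^ p = 1 + int p * y + y\<^sup>2 * w"
      using one_plus_power_expansion by blast
    obtain q where q: "r + m = Suc (Suc q)"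
      using assms(2) by (metis Suc_le_D add_Suc numeral_2_eq_2 Suc_le_mono)
    define t' where "t' = t + int p * (int p ^ q * t\<^sup>2 * w)"
    have "(1 + int p ^ r) ^ (p ^ Suc m) = (1 + y) ^ p"
      unfolding y_def t[symmetric] power_mult[symmetric] by (simp add: mult.commute)
    also note w
    also have "1 + int p * y + y\<^sup>2 * w = 1 + int p ^ (r + Suc m) * t'"
      unfolding t'_def y_def add_Suc_right q
      by (simp add: algebra_simps power2_eq_square)
    finally have "(1 + int p ^ r) ^ (p ^ Suc m) = 1 + int p ^ (r + Suc m) * t'" .
    moreover have "\<not> int p dvd t'"
      unfolding t'_def using nt by (metis dvd_add_left_iff dvd_triv_left)
    ultimately show ?case by blast
  qed
  with that show thesis by blast
qed

lemma prime_power_dvd_mult_unit_iff: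
  fixes p :: nat and t :: int
  assumes "prime p" "\<not> int p dvd t"
  shows "int p ^ n dvd int p ^ k * t \<longleftrightarrow> n \<le> k"
proof -
  have "coprime (int p) t"
    using assms by (intro prime_imp_coprime) simp_all
  then have "coprime (int p ^ n) t" by simp
  then have "int p ^ n dvd int p ^ k * t \<longleftrightarrow> int p ^ n dvd int p ^ k"
    by (rule coprime_dvd_mult_left_iff)
  also have "\<dots> \<longleftrightarrow> n \<le> k"
    using prime_gt_1_nat[OF assms(1)] by (subst dvd_power_iff) auto
  finally show ?thesis .
qed

text \<open>In valuations: v(u^j - 1) = r + v(j) for u = 1 + p^r and j > 0. Write j = p^s j' with j'
  prime to p. The exponent p^s raises the valuation from r to r + s, and j' leaves it there because
  the linear term j' y dominates the square. Truncated subtraction in n - r absorbs the case n \<le>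
  r.\<close>

lemma prime_power_dvd_one_plus_power_minus_one_iff:
  fixes p r n j :: nat
  assumes p: "prime p" and r: "2 \<le> r"
  shows "int p ^ n dvd (1 + int p ^ r) ^ j - 1 \<longleftrightarrow> p ^ (n - r) dvd j"
proof (cases "j = 0")
  case False
  then obtain j' where j: "j = p ^ multiplicity p j * j'" and nj': "\<not> p dvd j'"
    using multiplicity_decompose'[of j p] p by (metis not_prime_unit)
  define s where "s = multiplicity p j"
  obtain t where t: "(1 + int p ^ r) ^ (p ^ s) = 1 + int p ^ (r + s) * t" and nt: "\<not> int p dvd t"
    using one_plus_prime_power_power[OF p r] .
  define y where "y = int p ^ (r + s) * t"
  obtain w where w: "(1 + y) ^ j' = 1 + int j' * y + y\<^sup>2 * w"
    using one_plus_power_expansion by blast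
  obtain q where q: "r + s = Suc q"
    using r by (cases r) auto
  define t' where "t' = int j' * t + int p * (int p ^ q * t\<^sup>2 * w)"
  have "(1 + int p ^ r) ^ j = (1 + y) ^ j'"
    unfolding y_def t[symmetric] by (metis j power_mult s_def)
  also note w
  also have "1 + int j' * y + y\<^sup>2 * w = 1 + int p ^ (r + s) * t'"
    unfolding t'_def y_def q by (simp add: algebra_simps power2_eq_square)
  finally have eq: "(1 + int p ^ r) ^ j - 1 = int p ^ (r + s) * t'" by simp
  have "\<not> int p dvd int j' * t"
    using p nj' nt by (simp add: prime_dvd_mult_iff)
  then have "\<not> int p dvd t'"
    unfolding t'_def by (metis dvd_add_left_iff dvd_triv_left)
  then have "int p ^ n dvd (1 + int p ^ r) ^ j - 1 \<longleftrightarrow> n \<le> r + s"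
    unfolding eq using p by (rule prime_power_dvd_mult_unit_iff[rotated])
  moreover have "p ^ (n - r) dvd j \<longleftrightarrow> n - r \<le> s"
    unfolding s_def using False p by (intro power_dvd_iff_le_multiplicity) (auto simp: prime_nat_iff)
  ultimately show ?thesis by linarith
qed simp

subsection \<open>Commutators, powers and the center\<close>

context group
begin

lemma group_commutator_eq_one_iff:
  assumes "x \<in> carrier G" "y \<in> carrier G"
  shows "group_commutator G x y = \<one> \<longleftrightarrow> x \<otimes> y = y \<otimes> x"
proof -
  have "group_commutator G x y = inv (y \<otimes> x) \<otimes> (x \<otimes> y)"
    using assms by (simp add: group_commutator_def inv_mult_group m_assoc)
  then show ?thesis
    using assms by (metis inv_solve_left m_closed one_closed r_one)
qed

lemma commutator_subgroup_le:
  assumes "subgroup K G" "H \<subseteq> carrier G"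
    and "\<And>x y. x \<in> H \<Longrightarrow> y \<in> carrier G \<Longrightarrow> group_commutator G x y \<in> K"
  shows "commutator_subgroup G H (carrier G) \<subseteq> K"
  unfolding commutator_subgroup_def
  using assms by (intro generate_subgroup_incl) auto

lemma power_subgroup_is_subgroup:
  "H \<subseteq> carrier G \<Longrightarrow> subgroup (power_subgroup G H k) G"
  unfolding power_subgroup_def by (intro generate_is_subgroup) auto

lemma int_pow_in_power_subgroup:
  assumes "x [^] i \<in> H" "x \<in> carrier G"
  shows "x [^] (i * int k) \<in> power_subgroup G H k"
proof -
  have "x [^] (i * int k) = (x [^] i) [^] k"
    using assms(2) by (simp add: int_pow_pow[symmetric] int_pow_int)
  then show ?thesis
    unfolding power_subgroup_def using assms(1) by (auto intro: generate.incl)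
qed

lemma power_power_in_subgroup:
  assumes "subgroup H G" "x \<in> carrier G" "x [^] (p ^ s) \<in> H" "s \<le> t"
  shows "x [^] ((p::nat) ^ t) \<in> H"
proof -
  have "x [^] (p ^ t) = (x [^] (p ^ s)) [^] int (p ^ (t - s))"
    using assms(2,4) by (simp only: int_pow_int nat_pow_pow flip: power_add) simp
  then show ?thesis
    using assms(1,3) subgroup_int_pow_closed by simp
qed

lemma subgroup_center_normal:
  assumes "subgroup H G" "H \<subseteq> group_center G"
  shows "H \<lhd> G"
proof (rule normal_invI[OF assms(1)])
  fix x h assume x: "x \<in> carrier G" and h: "h \<in> H"
  then have "h \<in> carrier G" "x \<otimes> h = h \<otimes> x"
    using assms(2) by (auto simp: group_center_def)
  then show "x \<otimes> h \<otimes> inv x \<in> H"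
    using x h by (simp add: m_assoc)
qed

lemma subgroup_group_center: "subgroup (group_center G) G"
proof (rule subgroupI)
  show "group_center G \<noteq> {}"
    unfolding group_center_def by force
  fix z assume z: "z \<in> group_center G"
  then have zc: "z \<in> carrier G" by (simp add: group_center_def)
  show "inv z \<in> group_center G"
    unfolding group_center_def
  proof (intro CollectI conjI ballI)
    fix x assume x: "x \<in> carrier G"
    have "x \<otimes> z = z \<otimes> x" using z x by (simp add: group_center_def)
    then have "inv z \<otimes> (x \<otimes> z) = x"
      using zc x by (simp add: m_assoc[symmetric])
    then show "inv z \<otimes> x = x \<otimes> inv z"
      using zc x by (metis inv_solve_right inv_closed m_assoc m_closed)
  qed (use zc in simp)
  fix y assume y: "y \<in> group_center G"
  then have yc: "y \<in> carrier G" by (simp add: group_center_def)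
  show "z \<otimes> y \<in> group_center G"
    unfolding group_center_def
  proof (intro CollectI conjI ballI)
    fix x assume x: "x \<in> carrier G"
    have "x \<otimes> z = z \<otimes> x" "x \<otimes> y = y \<otimes> x" using y z x by (simp_all add: group_center_def)
    then show "z \<otimes> y \<otimes> x = x \<otimes> (z \<otimes> y)"
      using zc x yc by (metis m_assoc)
  qed (use zc yc in simp)
qed (auto simp: group_center_def)

lemma power_subgroup_center_normal: "power_subgroup G (group_center G) k \<lhd> G"
proof (rule subgroup_center_normal)
  have sub: "subgroup (group_center G) G" by (rule subgroup_group_center)
  have powers: "(\<lambda>x. x [^] k) ` group_center G \<subseteq> group_center G"
    using subgroup_int_pow_closed[OF sub, of _ "int k"] by (auto simp: int_pow_int)
  then have "(\<lambda>x. x [^] k) ` group_center G \<subseteq> carrier G"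
    using subgroup.subset[OF sub] by blast
  then show "subgroup (power_subgroup G (group_center G) k) G"
    unfolding power_subgroup_def by (rule generate_is_subgroup)
  show "power_subgroup G (group_center G) k \<subseteq> group_center G"
    unfolding power_subgroup_def using powers sub by (rule generate_subgroup_incl)
qed

end

subsection \<open>Metacyclic groups\<close>

text \<open>The commutator relation is stored as a rule that moves \<open>b\<close> to the left. The
  exponents only bound orders from above, so the conditions survive quotients; l = n encodes b^(p^m)
  = 1. Generation is left to the extension \<open>metacyclic\<close>, because verifying it for a
  presented group already uses the normal form arithmetic proved here.\<close>

locale metacyclic_pair = group G for G (structure) +
  fixes a b and p n m l r :: nat
  assumes prime_p: "prime p" and r_ge_2: "2 \<le> r"
    and a_closed [simp]: "a \<in> carrier G" and b_closed [simp]: "b \<in> carrier G"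
    and a_power: "a [^] (p ^ n) = \<one>"
    and b_power: "b [^] (p ^ m) = a [^] (p ^ l)"
    and a_mult_b: "a \<otimes> b = b \<otimes> a [^] (1 + p ^ r)"
begin

abbreviation u :: int where "u \<equiv> 1 + int p ^ r"

text \<open>Conjugation x -> b^-1 x b is an endomorphism with a -> a^u. This settles all integer
  powers of \<open>a\<close> at once, and each \<open>b\<close> that is passed multiplies the
  exponent by \<open>u\<close>.\<close>

lemma int_pow_a_mult_pow_b:
  "a [^] (i::int) \<otimes> b [^] (k::nat) = b [^] k \<otimes> a [^] (i * u ^ k)"
proof (induction k arbitrary: i)
  case 0
  show ?case by simp
next
  case (Suc k)
  have u: "a [^] (1 + p ^ r) = a [^] u"
    by (simp only: int_pow_int[symmetric]) simp
  have "(\<lambda>x. inv b \<otimes> (x \<otimes> b)) \<in> hom G G"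
  proof (rule homI)
    fix x y assume xy: "x \<in> carrier G" "y \<in> carrier G"
    have "inv b \<otimes> (x \<otimes> b) \<otimes> (inv b \<otimes> (y \<otimes> b)) = inv b \<otimes> (x \<otimes> ((b \<otimes> inv b) \<otimes> (y \<otimes> b)))"
      using xy by (simp only: m_assoc m_closed inv_closed b_closed)
    then show "inv b \<otimes> (x \<otimes> y \<otimes> b) = inv b \<otimes> (x \<otimes> b) \<otimes> (inv b \<otimes> (y \<otimes> b))"
      using xy by (simp add: m_assoc)
  qed simp
  then have gh: "group_hom G G (\<lambda>x. inv b \<otimes> (x \<otimes> b))"
    by unfold_locales
  have "inv b \<otimes> (a [^] j \<otimes> b) = (inv b \<otimes> (a \<otimes> b)) [^] j" for j :: int
    using group_hom.hom_int_pow[OF gh a_closed] .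
  moreover have "inv b \<otimes> (a \<otimes> b) = a [^] u"
    unfolding a_mult_b u by (simp add: m_assoc[symmetric])
  ultimately have "inv b \<otimes> (a [^] j \<otimes> b) = a [^] (u * j)" for j :: int
    by (simp add: int_pow_pow)
  then have step: "a [^] j \<otimes> b = b \<otimes> a [^] (u * j)" for j :: int
    by (metis a_closed b_closed int_pow_closed m_closed inv_solve_left)
  have "a [^] i \<otimes> b [^] Suc k = (a [^] i \<otimes> b [^] k) \<otimes> b"
    by (simp add: m_assoc)
  also have "\<dots> = b [^] k \<otimes> (a [^] (i * u ^ k) \<otimes> b)"
    unfolding Suc by (simp add: m_assoc)
  also have "\<dots> = b [^] Suc k \<otimes> a [^] (u * (i * u ^ k))"
    unfolding step by (simp add: m_assoc)
  finally show ?case by (simp add: algebra_simps)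
qed

lemma normal_form_mult:
  "(b [^] (j::nat) \<otimes> a [^] (i::int)) \<otimes> (b [^] (k::nat) \<otimes> a [^] (h::int))
    = b [^] (j + k) \<otimes> a [^] (i * u ^ k + h)"
proof -
  have "(b [^] j \<otimes> a [^] i) \<otimes> (b [^] k \<otimes> a [^] h) = b [^] j \<otimes> ((a [^] i \<otimes> b [^] k) \<otimes> a [^] h)"
    by (simp add: m_assoc)
  also have "\<dots> = (b [^] j \<otimes> b [^] k) \<otimes> (a [^] (i * u ^ k) \<otimes> a [^] h)"
    unfolding int_pow_a_mult_pow_b by (simp add: m_assoc)
  finally show ?thesis by (simp add: nat_pow_mult int_pow_mult)
qed

text \<open>The products x y and y x contain the same power of \<open>b\<close>, so (y x)^-1 (x y)
  is a power of \<open>a\<close>. Its exponent is the difference (i u^k + h) - (h u^j + i).\<close>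

lemma normal_form_commutator:
  "group_commutator G (b [^] (j::nat) \<otimes> a [^] (i::int)) (b [^] (k::nat) \<otimes> a [^] (h::int))
    = a [^] (i * (u ^ k - 1) - h * (u ^ j - 1))"
proof -
  define x y where "x = b [^] j \<otimes> a [^] i" and "y = b [^] k \<otimes> a [^] h"
  have [simp]: "x \<in> carrier G" "y \<in> carrier G" by (simp_all add: x_def y_def)
  have "x \<otimes> y = b [^] (j + k) \<otimes> a [^] (i * u ^ k + h)"
    unfolding x_def y_def by (rule normal_form_mult)
  also have "\<dots> = (b [^] (k + j) \<otimes> a [^] (h * u ^ j + i))
      \<otimes> a [^] (i * (u ^ k - 1) - h * (u ^ j - 1))"
    by (simp add: m_assoc add.commute int_pow_mult[symmetric]) (simp add: algebra_simps)
  also have "b [^] (k + j) \<otimes> a [^] (h * u ^ j + i) = y \<otimes> x"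
    unfolding x_def y_def by (rule normal_form_mult[symmetric])
  finally have xy: "x \<otimes> y = (y \<otimes> x) \<otimes> a [^] (i * (u ^ k - 1) - h * (u ^ j - 1))" .
  have "group_commutator G x y = inv (y \<otimes> x) \<otimes> (x \<otimes> y)"
    by (simp add: group_commutator_def inv_mult_group m_assoc)
  also have "\<dots> = a [^] (i * (u ^ k - 1) - h * (u ^ j - 1))"
    unfolding xy by (subst m_assoc[symmetric]) simp_all
  finally show ?thesis by (simp add: x_def y_def)
qed

lemma u_power_minus_one_dvd: "int p ^ r dvd u ^ k - 1"
  using prime_power_dvd_one_plus_power_minus_one_iff[OF prime_p r_ge_2, of r k] by simp

text \<open>Powers of \<open>b\<close> carry natural exponents because u^j has to be an integer. A
  finite exponent for \<open>b\<close> makes its inverse a power of this kind too.\<close>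

lemma b_power_eq_one: "b [^] (p ^ (m + n)) = \<one>"
proof -
  have "b [^] (p ^ (m + n)) = (b [^] (p ^ m)) [^] (p ^ n)"
    by (simp add: nat_pow_pow power_add)
  also have "\<dots> = (a [^] (p ^ n)) [^] (p ^ l)"
    unfolding b_power by (simp add: nat_pow_pow mult.commute)
  finally show ?thesis by (simp add: a_power)
qed

lemma inv_b_eq: "inv b = b [^] (p ^ (m + n) - 1)"
proof (rule inv_equality)
  have "b [^] (p ^ (m + n) - 1) \<otimes> b = b [^] Suc (p ^ (m + n) - 1)" by simp
  also have "Suc (p ^ (m + n) - 1) = p ^ (m + n)"
    using prime_gt_0_nat[OF prime_p] by simp
  finally show "b [^] (p ^ (m + n) - 1) \<otimes> b = \<one>" by (simp add: b_power_eq_one)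
qed simp_all

end

locale metacyclic = metacyclic_pair +
  assumes carrier_normal_form: "carrier G \<subseteq> {b [^] j \<otimes> a [^] i |(j::nat) (i::int). True}"
begin

lemma carrierE:
  assumes "x \<in> carrier G"
  obtains j :: nat and i :: int where "x = b [^] j \<otimes> a [^] i"
  using carrier_normal_form assms by blast

lemma commutator_in_power_subgroup:
  assumes "x \<in> carrier G" "y \<in> carrier G"
  obtains z :: int where "group_commutator G x y = a [^] (int p ^ r * z)"
proof -
  obtain j :: nat and i :: int where x: "x = b [^] j \<otimes> a [^] i"
    using assms(1) by (rule carrierE)
  obtain k :: nat and h :: int where y: "y = b [^] k \<otimes> a [^] h"
    using assms(2) by (rule carrierE)
  have "int p ^ r dvd i * (u ^ k - 1) - h * (u ^ j - 1)"
    by (intro dvd_diff dvd_mult u_power_minus_one_dvd)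
  then obtain z where "i * (u ^ k - 1) - h * (u ^ j - 1) = int p ^ r * z"
    by (rule dvdE)
  with that[of z] show thesis
    using normal_form_commutator[of j i k h] unfolding x y by simp
qed

text \<open>The factor \<open>i\<close> is kept, where a general commutator only yields a multiple
  of p^r. It makes commutation push a subgroup of <a> further down, as the chain for powerful
  nilpotence requires.\<close>

lemma power_of_a_commutator:
  assumes "y \<in> carrier G"
  obtains z :: int where "group_commutator G (a [^] (i::int)) y = a [^] (i * int p ^ r * z)"
proof -
  obtain k :: nat and h :: int where y: "y = b [^] k \<otimes> a [^] h"
    using assms by (rule carrierE)
  obtain z where z: "u ^ k - 1 = int p ^ r * z"
    using u_power_minus_one_dvd by (rule dvdE)
  show thesis
    using that[of z] normal_form_commutator[of 0 i k h] unfolding y z by (simp add: mult.assoc)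
qed

section \<open>Finiteness and prime power order\<close>

lemma int_pow_a_mod: "a [^] (i::int) = a [^] (i mod int p ^ n)"
proof -
  have "a [^] (int p ^ n) = \<one>"
    using a_power by (simp only: int_pow_int[symmetric] of_nat_power)
  then have "a [^] (int p ^ n * (i div int p ^ n)) = \<one>"
    by (simp add: int_pow_pow[symmetric])
  then have "a [^] (int p ^ n * (i div int p ^ n) + i mod int p ^ n) = a [^] (i mod int p ^ n)"
    by (simp only: int_pow_mult a_closed l_one int_pow_closed)
  then show ?thesis by simp
qed

lemma pow_b_mod: "b [^] (j::nat) = b [^] (j mod p ^ (m + n))"
proof -
  have "b [^] (p ^ (m + n) * (j div p ^ (m + n))) = \<one>"
    by (simp add: nat_pow_pow[symmetric] b_power_eq_one)
  then have "b [^] (p ^ (m + n) * (j div p ^ (m + n)) + j mod p ^ (m + n)) = b [^] (j mod p ^ (m + n))"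
    by (simp only: nat_pow_mult[symmetric] b_closed l_one nat_pow_closed)
  then show ?thesis by simp
qed

lemma finite_carrier: "finite (carrier G)"
proof -
  have "carrier G \<subseteq> (\<lambda>(j, i). b [^] j \<otimes> a [^] i) ` ({..<p ^ (m + n)} \<times> {0..<int p ^ n})"
  proof
    fix x assume "x \<in> carrier G"
    then obtain j :: nat and i :: int where x: "x = b [^] j \<otimes> a [^] i" by (rule carrierE)
    have "x = b [^] (j mod p ^ (m + n)) \<otimes> a [^] (i mod int p ^ n)"
      unfolding x using int_pow_a_mod pow_b_mod by metis
    moreover have "j mod p ^ (m + n) < p ^ (m + n)" "0 \<le> i mod int p ^ n" "i mod int p ^ n < int p ^ n"
      using prime_gt_0_nat[OF prime_p] by simp_all
    ultimately show "x \<in> (\<lambda>(j, i). b [^] j \<otimes> a [^] i) ` ({..<p ^ (m + n)} \<times> {0..<int p ^ n})"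
      by (intro image_eqI[of _ _ "(j mod p ^ (m + n), i mod int p ^ n)"]) simp_all
  qed
  then show ?thesis by (rule finite_subset) simp
qed

text \<open>The conjugate x t x^-1 equals t [t, x^-1], and both factors are powers of
  \<open>a\<close>.\<close>

lemma generate_a_normal: "generate G {a} \<lhd> G"
proof (rule normal_invI)
  show sub: "subgroup (generate G {a}) G" by (simp add: generate_is_subgroup)
  fix x t assume x: "x \<in> carrier G" and t: "t \<in> generate G {a}"
  then obtain i :: int where i: "t = a [^] i" by (auto simp: generate_pow)
  obtain z where "group_commutator G (a [^] i) (inv x) = a [^] (i * int p ^ r * z)"
    using x power_of_a_commutator[of "inv x"] by blast
  then have "group_commutator G t (inv x) \<in> generate G {a}"
    unfolding i by (auto simp: generate_pow)
  then have "t \<otimes> group_commutator G t (inv x) \<in> generate G {a}"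
    using sub t by (simp add: subgroup.m_closed)
  also have "t \<otimes> group_commutator G t (inv x) = x \<otimes> t \<otimes> inv x"
    using x unfolding group_commutator_def i by (simp add: m_assoc[symmetric])
  finally show "x \<otimes> t \<otimes> inv x \<in> generate G {a}" .
qed

text \<open>The order is the index of <a> times the order of <a>. The quotient by <a> is cyclic,
  generated by the image of \<open>b\<close>, so its order divides p^(m+n); the order of <a> divides
  p^n.\<close>

lemma finite_p_group: "finite_p_group p G"
proof -
  define T where "T = generate G {a}"
  interpret T: normal T G unfolding T_def by (rule generate_a_normal)
  interpret Q: group "G Mod T" by (rule T.factorgroup_is_group)
  interpret pr: group_hom G "G Mod T" "\<lambda>x. T #> x"
    by unfold_locales (rule T.r_coset_hom_Mod)
  have b: "T #> b \<in> carrier (G Mod T)" by simp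
  have a: "T #> a = \<one>\<^bsub>G Mod T\<^esub>"
    using T.rcos_const[of a] by (simp add: T_def generate.incl FactGroup_def is_group)
  have "carrier (G Mod T) \<subseteq> generate (G Mod T) {T #> b}"
  proof
    fix X assume "X \<in> carrier (G Mod T)"
    then obtain x where "x \<in> carrier G" "X = T #> x" by (auto simp: FactGroup_def RCOSETS_def)
    then obtain j :: nat and i :: int where "X = T #> (b [^] j \<otimes> a [^] i)" by (metis carrierE)
    also have "\<dots> = (T #> b) [^]\<^bsub>G Mod T\<^esub> j"
      by (simp only: pr.hom_mult pr.hom_nat_pow pr.hom_int_pow a a_closed b_closed nat_pow_closed
          int_pow_closed Q.int_pow_one Q.r_one Q.nat_pow_closed b)
    finally show "X \<in> generate (G Mod T) {T #> b}"
      using Q.generate_pow[OF b] by (auto simp flip: int_pow_int)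
  qed
  then have index: "card (rcosets T) = Q.ord (T #> b)"
    using Q.generate_incl[of "{T #> b}"] b Q.generate_pow_card[OF b]
    by (simp add: FactGroup_def subset_antisym)
  have "(T #> b) [^]\<^bsub>G Mod T\<^esub> (p ^ (m + n)) = \<one>\<^bsub>G Mod T\<^esub>"
    using pr.hom_nat_pow[OF b_closed, of "p ^ (m + n)"] pr.hom_one b_power_eq_one by metis
  then have "Q.ord (T #> b) dvd p ^ (m + n)"
    using Q.pow_eq_id[OF b] by blast
  then obtain k where k: "card (rcosets T) = p ^ k"
    unfolding index using divides_primepow_nat[OF prime_p] by blast
  have "card T = ord a" unfolding T_def by (simp add: generate_pow_card)
  also have "ord a dvd p ^ n" using a_power by (simp add: pow_eq_id)
  finally obtain k' where k': "card T = p ^ k'"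
    using divides_primepow_nat[OF prime_p] by blast
  have "order G = p ^ (k + k')"
    using lagrange[OF T.subgroup_axioms] by (simp add: k k' power_add)
  then show ?thesis
    unfolding finite_p_group_def using prime_p finite_carrier is_group by blast
qed

section \<open>Powerfulness and powerful nilpotence\<close>

lemma powerful: "powerful p G"
proof -
  obtain e where e: "r = Suc (Suc e)"
    using r_ge_2 by (metis Suc_le_D numeral_2_eq_2 Suc_le_mono)
  have "group_commutator G x y \<in> power_subgroup G (carrier G) k"
    if xy: "x \<in> carrier G" "y \<in> carrier G" and k: "k = p \<or> k = p ^ 2" for x y k
  proof -
    obtain z where "group_commutator G x y = a [^] (int p ^ r * z)"
      using commutator_in_power_subgroup xy by blast
    \<comment> \<open>Since r \<ge> 2, both p and p^2 split off from p^r; the latter is the exponent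
      4 demanded for p = 2.\<close>
    moreover have "\<exists>z'. int p ^ r * z = z' * int k"
      using k
    proof
      assume "k = p"
      then show ?thesis by (intro exI[of _ "int p ^ Suc e * z"]) (simp add: e)
    next
      assume "k = p ^ 2"
      then show ?thesis by (intro exI[of _ "int p ^ e * z"]) (simp add: e power2_eq_square)
    qed
    ultimately show ?thesis
      using int_pow_in_power_subgroup[of a _ "carrier G" k] by auto
  qed
  then have "commutator_subgroup G (carrier G) (carrier G) \<subseteq> power_subgroup G (carrier G) k"
    if "k = p \<or> k = p ^ 2" for k
    using that by (intro commutator_subgroup_le power_subgroup_is_subgroup) simp_all
  from this[of "if p = 2 then 4 else p"] show ?thesis
    unfolding powerful_def using finite_p_group by simp
qed

text \<open>Powers p of elements of <a^(p^(d+1))> are powers of \<open>a\<close> with exponent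
  divisible by p^(d+2). Commuting a^(p^d c) with any element supplies a factor p^r on top of p^d, so
  r \<ge> 2 pays for one step of the chain. At the top, [G,G] lies in <a^(p^r)>, hence in
  <a>^p.\<close>

lemma powerfully_nilpotent: "powerfully_nilpotent p G"
proof -
  \<comment> \<open>Index 0 gives <a^(p^n)> = 1, index n gives <a>, and the whole group sits at n +
    1.\<close>
  define H where "H i = (if i \<le> n then generate G {a [^] (int p ^ (n - i))} else carrier G)" for i
  have H_eq: "H i = {a [^] (int p ^ (n - i) * z) |z::int. True}" if "i \<le> n" for i
    using that by (simp add: H_def generate_pow int_pow_pow)
  have sub: "subgroup (H i) G" for i
    by (simp add: H_def generate_is_subgroup subgroup_self)
  have Hc: "H i \<subseteq> carrier G" for i
    using sub by (rule subgroup.subset)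
  have H_Suc: "H (Suc n) = carrier G" by (simp add: H_def)
  obtain e where e: "r = Suc (Suc e)"
    using r_ge_2 by (metis Suc_le_D numeral_2_eq_2 Suc_le_mono)
  have "H (i - 1) \<subseteq> H i \<and> commutator_subgroup G (H i) (carrier G) \<subseteq> power_subgroup G (H (i - 1)) p"
    if i: "i \<in> {1..Suc n}" for i
  proof (cases "i = Suc n")
    case True
    have "group_commutator G x y \<in> power_subgroup G (H n) p"
      if xy: "x \<in> carrier G" "y \<in> carrier G" for x y
    proof -
      obtain z where "group_commutator G x y = a [^] (int p ^ r * z)"
        using commutator_in_power_subgroup xy by blast
      also have "int p ^ r * z = (int p ^ Suc e * z) * int p"
        by (simp add: e algebra_simps)
      also have "a [^] \<dots> \<in> power_subgroup G (H n) p"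
        by (rule int_pow_in_power_subgroup) (auto simp: H_eq)
      finally show ?thesis .
    qed
    then have "commutator_subgroup G (H i) (carrier G) \<subseteq> power_subgroup G (H n) p"
      unfolding True H_Suc by (intro commutator_subgroup_le power_subgroup_is_subgroup Hc) simp_all
    with Hc show ?thesis by (simp add: True H_Suc)
  next
    case False
    with i obtain d where d: "i \<le> n" "i - 1 \<le> n" "n - (i - 1) = Suc d" "n - i = d" "1 \<le> i"
      by (auto simp: Suc_diff_le)
    have "\<exists>z'. a [^] (int p ^ Suc d * z) = a [^] (int p ^ d * z')" for z
      by (intro exI[of _ "int p * z"]) (simp add: algebra_simps)
    then have "H (i - 1) \<subseteq> H i"
      unfolding H_eq[OF d(1)] H_eq[OF d(2)] d(3,4) by blast
    moreover have "group_commutator G x y \<in> power_subgroup G (H (i - 1)) p"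
      if x: "x \<in> H i" and y: "y \<in> carrier G" for x y
    proof -
      obtain c where "x = a [^] (int p ^ d * c)" using x unfolding H_eq[OF d(1)] d(4) by blast
      moreover obtain z where "group_commutator G (a [^] (int p ^ d * c)) y
          = a [^] ((int p ^ d * c) * int p ^ r * z)"
        using power_of_a_commutator y by blast
      ultimately have "group_commutator G x y = a [^] ((int p ^ Suc d * (c * int p ^ e * z)) * int p)"
        by (simp add: e algebra_simps)
      also have "\<dots> \<in> power_subgroup G (H (i - 1)) p"
        unfolding H_eq[OF d(2)] d(3) by (rule int_pow_in_power_subgroup) auto
      finally show ?thesis .
    qed
    ultimately show ?thesis
      by (intro conjI commutator_subgroup_le power_subgroup_is_subgroup Hc)
  qed
  moreover have "H 0 = {\<one>}"
    using int_pow_a_mod[of "int p ^ n"] by (simp add: H_def generate_one)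
  ultimately show ?thesis
    unfolding powerfully_nilpotent_def using powerful sub H_Suc
    by (intro conjI exI[of _ "Suc n"] exI[of _ H]) simp_all
qed

section \<open>Commutativity and the center\<close>

lemma comm_group_iff: "comm_group G \<longleftrightarrow> a [^] (p ^ r) = \<one>"
proof
  have "group_commutator G a b = a [^] int (p ^ r)"
    using normal_form_commutator[of 0 1 1 0] by simp
  then have commutator: "group_commutator G a b = a [^] (p ^ r)"
    by (simp only: int_pow_int)
  assume "comm_group G"
  then have "a \<otimes> b = b \<otimes> a"
    by (simp add: comm_groupE(4))
  then show "a [^] (p ^ r) = \<one>"
    using group_commutator_eq_one_iff[of a b] commutator by simp
next
  assume "a [^] (p ^ r) = \<one>"
  then have "a [^] (int p ^ r) = \<one>"
    by (simp only: int_pow_int[symmetric] of_nat_power)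
  then have one: "a [^] (int p ^ r * z) = \<one>" for z :: int
    by (simp add: int_pow_pow[symmetric])
  show "comm_group G"
  proof (rule group_comm_groupI)
    fix x y assume xy: "x \<in> carrier G" "y \<in> carrier G"
    then obtain z where "group_commutator G x y = a [^] (int p ^ r * z)"
      using commutator_in_power_subgroup by blast
    with xy show "x \<otimes> y = y \<otimes> x"
      using group_commutator_eq_one_iff one by simp
  qed
qed

text \<open>The exact order of \<open>a\<close> enters here: commutators are powers of
  \<open>a\<close>, so their triviality becomes divisibility by p^n.\<close>

lemma normal_form_in_center_iff:
  assumes ord: "ord a = p ^ n" and "r \<le> n"
  shows "b [^] (j::nat) \<otimes> a [^] (i::int) \<in> group_center G
    \<longleftrightarrow> p ^ (n - r) dvd j \<and> int p ^ (n - r) dvd i" (is "?x \<in> _ \<longleftrightarrow> ?R")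
proof
  have one_iff: "a [^] i = \<one> \<longleftrightarrow> int p ^ n dvd i" for i :: int
    by (simp add: int_pow_eq_id ord)
  have n: "int p ^ n = int p ^ (n - r) * int p ^ r"
    using \<open>r \<le> n\<close> by (simp flip: power_add)
  {
    assume "?x \<in> group_center G"
    then have central: "group_commutator G ?x (b [^] (k::nat) \<otimes> a [^] (h::int)) = \<one>" for k h
      using group_commutator_eq_one_iff[of ?x "b [^] k \<otimes> a [^] h"] by (simp add: group_center_def)
    \<comment> \<open>The generator \<open>a\<close> is k = 0, h = 1 and \<open>b\<close> is k = 1,
      h = 0. Commuting with these two forces both conditions.\<close>
    have "int p ^ n dvd u ^ j - 1"
      using central[of 0 1] unfolding normal_form_commutator one_iff by (simp add: dvd_diff_commute)
    moreover have "int p ^ n dvd i * int p ^ r"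
      using central[of 1 0] unfolding normal_form_commutator one_iff by simp
    moreover have "int p ^ r \<noteq> 0"
      using prime_gt_0_nat[OF prime_p] by simp
    ultimately show ?R
      unfolding prime_power_dvd_one_plus_power_minus_one_iff[OF prime_p r_ge_2]
      by (auto simp: n)
  }
  assume R: ?R
  show "?x \<in> group_center G"
    unfolding group_center_def
  proof (intro CollectI conjI ballI)
    fix y assume y: "y \<in> carrier G"
    then obtain k :: nat and h :: int where y': "y = b [^] k \<otimes> a [^] h" by (rule carrierE)
    have "int p ^ n dvd i * (u ^ k - 1)"
      unfolding n using R u_power_minus_one_dvd by (intro mult_dvd_mono) simp_all
    moreover have "int p ^ n dvd u ^ j - 1"
      using R prime_power_dvd_one_plus_power_minus_one_iff[OF prime_p r_ge_2] by blast
    ultimately have "group_commutator G ?x y = \<one>"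
      unfolding y' normal_form_commutator one_iff by (intro dvd_diff) simp_all
    then show "?x \<otimes> y = y \<otimes> ?x"
      using group_commutator_eq_one_iff[of ?x y] y by simp
  qed simp
qed

lemma power_subgroup_center:
  assumes ord: "ord a = p ^ n" and "r \<le> n"
  shows "power_subgroup G (group_center G) p
    = generate G {a [^] (p ^ (n - r + 1)), b [^] (p ^ (n - r + 1))}" (is "_ = generate G ?S")
proof
  have sub: "subgroup (generate G ?S) G"
    by (rule generate_is_subgroup) simp
  show "power_subgroup G (group_center G) p \<subseteq> generate G ?S"
    unfolding power_subgroup_def
  proof (intro generate_subgroup_incl sub image_subsetI)
    fix x assume x: "x \<in> group_center G"
    then obtain j :: nat and i :: int where x_eq: "x = b [^] j \<otimes> a [^] i"
      unfolding group_center_def by (blast elim: carrierE)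
    with x have "p ^ (n - r) dvd j" "int p ^ (n - r) dvd i"
      using normal_form_in_center_iff[OF assms] by blast+
    then obtain j' i' where j: "j = p ^ (n - r) * j'" and i: "i = int p ^ (n - r) * i'"
      by (auto elim!: dvdE)
    \<comment> \<open>The criterion for j = 0 shows that a^i alone is central. The two factors of
      \<open>x\<close> therefore commute, and the p-th power distributes over them.\<close>
    have "a [^] i \<in> group_center G"
      using normal_form_in_center_iff[OF assms, of 0 i] i by simp
    then have comm: "a [^] i \<otimes> b [^] j = b [^] j \<otimes> a [^] i"
      by (simp add: group_center_def)
    have "x [^] p = (b [^] j) [^] p \<otimes> (a [^] i) [^] p"
      unfolding x_eq using comm by (intro pow_mult_distrib) simp_all
    moreover have "(b [^] j) [^] p = (b [^] (p ^ (n - r + 1))) [^] j'"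
      by (simp add: nat_pow_pow j mult_ac)
    moreover have "(a [^] i) [^] p = (a [^] (p ^ (n - r + 1))) [^] i'"
    proof -
      have "(a [^] i) [^] p = a [^] (i * int p)"
        by (simp add: int_pow_pow[symmetric] int_pow_int)
      also have "i * int p = int (p ^ (n - r + 1)) * i'"
        by (simp add: i mult_ac)
      also have "a [^] \<dots> = (a [^] (p ^ (n - r + 1))) [^] i'"
        by (simp only: int_pow_pow[symmetric] a_closed int_pow_int)
      finally show ?thesis .
    qed
    moreover have "(a [^] (p ^ (n - r + 1))) [^] i' \<in> generate G ?S"
      using sub by (intro subgroup_int_pow_closed) (auto intro: generate.incl)
    moreover have "(b [^] (p ^ (n - r + 1))) [^] int j' \<in> generate G ?S"
      using sub by (intro subgroup_int_pow_closed) (auto intro: generate.incl)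
    ultimately show "x [^] p \<in> generate G ?S"
      using sub by (simp add: subgroup.m_closed int_pow_int)
  qed
next
  have "a [^] (p ^ (n - r)) \<in> group_center G"
    using normal_form_in_center_iff[OF assms, of 0 "int (p ^ (n - r))"]
    by (simp only: int_pow_int) simp
  moreover have "b [^] (p ^ (n - r)) \<in> group_center G"
    using normal_form_in_center_iff[OF assms, of "p ^ (n - r)" 0] by simp
  moreover have "x [^] (p ^ (n - r + 1)) = (x [^] (p ^ (n - r))) [^] p" if "x \<in> carrier G" for x
    using that by (simp add: nat_pow_pow mult.commute)
  ultimately have "?S \<subseteq> (\<lambda>x. x [^] p) ` group_center G"
    by auto
  then show "generate G ?S \<subseteq> power_subgroup G (group_center G) p"
    unfolding power_subgroup_def by (rule mono_generate)
qed

text \<open>All parameters stay the same although orders may drop. For the descendant this yields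
  powerful nilpotence independently of its presentation.\<close>

lemma metacyclic_Mod:
  assumes "N \<lhd> G"
  shows "metacyclic (G Mod N) (N #> a) (N #> b) p n m l r"
proof -
  interpret N: normal N G by (rule assms)
  interpret Q: group "G Mod N" by (rule N.factorgroup_is_group)
  interpret pr: group_hom G "G Mod N" "\<lambda>x. N #> x"
    by unfold_locales (rule N.r_coset_hom_Mod)
  show ?thesis
  proof
    show "N #> a \<in> carrier (G Mod N)" "N #> b \<in> carrier (G Mod N)" by simp_all
    show "(N #> a) [^]\<^bsub>G Mod N\<^esub> (p ^ n) = \<one>\<^bsub>G Mod N\<^esub>"
      using pr.hom_nat_pow[OF a_closed] a_power pr.hom_one by metis
    show "(N #> b) [^]\<^bsub>G Mod N\<^esub> (p ^ m) = (N #> a) [^]\<^bsub>G Mod N\<^esub> (p ^ l)"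
      using pr.hom_nat_pow[OF a_closed] pr.hom_nat_pow[OF b_closed] b_power by metis
    show "(N #> a) \<otimes>\<^bsub>G Mod N\<^esub> (N #> b)
        = (N #> b) \<otimes>\<^bsub>G Mod N\<^esub> (N #> a) [^]\<^bsub>G Mod N\<^esub> (1 + p ^ r)"
      using pr.hom_mult[OF a_closed b_closed] pr.hom_mult[OF b_closed, of "a [^] (1 + p ^ r)"]
        pr.hom_nat_pow[OF a_closed, of "1 + p ^ r"] a_mult_b by (metis a_closed nat_pow_closed)
    show "carrier (G Mod N) \<subseteq>
        {(N #> b) [^]\<^bsub>G Mod N\<^esub> j \<otimes>\<^bsub>G Mod N\<^esub> (N #> a) [^]\<^bsub>G Mod N\<^esub> i |(j::nat) (i::int). True}"
    proof
      fix X assume "X \<in> carrier (G Mod N)"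
      then obtain x where "x \<in> carrier G" and X: "X = N #> x"
        by (auto simp: FactGroup_def RCOSETS_def)
      then obtain j :: nat and i :: int where x: "x = b [^] j \<otimes> a [^] i" by (metis carrierE)
      have "X = (N #> b) [^]\<^bsub>G Mod N\<^esub> j \<otimes>\<^bsub>G Mod N\<^esub> (N #> a) [^]\<^bsub>G Mod N\<^esub> i"
        by (simp only: X x pr.hom_mult pr.hom_nat_pow pr.hom_int_pow a_closed b_closed
            nat_pow_closed int_pow_closed)
      then show "X \<in> {(N #> b) [^]\<^bsub>G Mod N\<^esub> j \<otimes>\<^bsub>G Mod N\<^esub> (N #> a) [^]\<^bsub>G Mod N\<^esub> i
          |(j::nat) (i::int). True}" by blast
    qed
  qed (fact prime_p r_ge_2)+
qed

end

subsection \<open>Presented groups and their quotients\<close>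

lemma carrier_presented_group: "carrier (presented_group R) = range (word_class R)"
  by (simp add: presented_group_def)

lemma one_presented_group: "\<one>\<^bsub>presented_group R\<^esub> = word_class R []"
  by (simp add: presented_group_def)

lemma word_class_closed [simp]: "word_class R w \<in> carrier (presented_group R)"
  by (simp add: carrier_presented_group)

lemma word_class_gen_power:
  "word_class R (gen_power x k) = word_class R [(x, True)] [^]\<^bsub>presented_group R\<^esub> k"
proof (induction k)
  case 0
  show ?case by (simp add: gen_power_def one_presented_group)
next
  case (Suc k)
  have "gen_power x (Suc k) = gen_power x k @ [(x, True)]"
    by (simp add: gen_power_def replicate_append_same)
  then show ?case by (simp add: Suc mult_word_class[symmetric])
qed

lemma word_class_inverse_letter:
  "word_class R [(x, False)] = inv\<^bsub>presented_group R\<^esub> word_class R [(x, True)]"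
proof -
  interpret group "presented_group R" by (rule group_presented_group)
  have "word_class R [(x, False)] \<otimes>\<^bsub>presented_group R\<^esub> word_class R [(x, True)]
      = \<one>\<^bsub>presented_group R\<^esub>"
    using word_cong.cancel[of R x False]
    by (simp add: mult_word_class one_presented_group word_class_eq_iff)
  then show ?thesis by (metis inv_equality word_class_closed)
qed

lemma word_cong_lift:
  assumes "\<And>v w. (v, w) \<in> R \<Longrightarrow> word_cong R' v w" and "word_cong R v w"
  shows "word_cong R' v w"
  using assms(2)
proof induction
  case (relation v w)
  then show ?case by (rule assms(1))
qed (blast intro: word_cong.intros)+

text \<open>The induced map of von Dyck's theorem. The union avoids choosing a representative; it
  collapses to a single class as soon as every relation of the source follows from
  \<open>R'\<close>.\<close>

definition presentation_map ::
  "('a word \<times> 'a word) set \<Rightarrow> 'a word set \<Rightarrow> 'a word set" where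
  "presentation_map R' X = (\<Union>w\<in>X. word_class R' w)"

lemma presentation_map_word_class:
  assumes "\<And>v w. (v, w) \<in> R \<Longrightarrow> word_cong R' v w"
  shows "presentation_map R' (word_class R w) = word_class R' w"
proof -
  have "word_class R' v = word_class R' w" if "v \<in> word_class R w" for v
    using that word_cong_lift[where R = R and R' = R' and v = w and w = v] assms
    by (simp add: word_class_def[of R] word_class_eq_iff word_cong.sym)
  moreover have "w \<in> word_class R w"
    by (simp add: word_class_def word_cong.refl)
  ultimately show ?thesis unfolding presentation_map_def by blast
qed

lemma group_hom_presentation_map:
  assumes "\<And>v w. (v, w) \<in> R \<Longrightarrow> word_cong R' v w"
  shows "group_hom (presented_group R) (presented_group R') (presentation_map R')"
proof -
  have "presentation_map R' \<in> hom (presented_group R) (presented_group R')"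
    using presentation_map_word_class[OF assms]
    by (auto intro!: homI simp: carrier_presented_group mult_word_class)
  then show ?thesis
    by (simp add: group_hom_def group_hom_axioms_def group_presented_group)
qed

text \<open>Sending a word to its coset of \<open>N\<close> respects products and, by
  \<open>R'N\<close>, all relations of \<open>R'\<close>. So words equal under \<open>R'\<close>
  have equal cosets, which puts the kernel of the induced map inside \<open>N\<close>; the first
  isomorphism theorem finishes.\<close>

lemma presented_group_Mod_iso:
  assumes RR': "\<And>v w. (v, w) \<in> R \<Longrightarrow> word_cong R' v w"
    and normal: "N \<lhd> presented_group R"
    and N: "N \<subseteq> kernel (presented_group R) (presented_group R') (presentation_map R')"
    and R'N: "\<And>v w. (v, w) \<in> R' \<Longrightarrow>
      N #>\<^bsub>presented_group R\<^esub> word_class R v = N #>\<^bsub>presented_group R\<^esub> word_class R w"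
  shows "presented_group R Mod N \<cong> presented_group R'"
proof -
  let ?G = "presented_group R" and ?f = "presentation_map R'"
  interpret group_hom ?G "presented_group R'" ?f
    using RR' by (rule group_hom_presentation_map)
  interpret N: normal N ?G by (rule normal)
  note f = presentation_map_word_class[OF RR']
  interpret Q: group "?G Mod N" by (rule N.factorgroup_is_group)
  define \<pi> where "\<pi> w = N #>\<^bsub>?G\<^esub> word_class R w" for w
  have \<pi>_append: "\<pi> (v @ w) = \<pi> v <#>\<^bsub>?G\<^esub> \<pi> w" for v w
    unfolding \<pi>_def by (simp add: N.rcos_sum mult_word_class)
  have \<pi>_cong: "\<pi> v = \<pi> w" if "word_cong R' v w" for v w
    using that
  proof induction
    case (relation v w)
    then show ?case unfolding \<pi>_def by (rule R'N)
  next
    case (cancel x e)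
    have "word_class R [(x, e), (x, \<not> e)] = word_class R []"
      by (simp add: word_class_eq_iff word_cong.cancel)
    then show ?case by (simp add: \<pi>_def)
  qed (simp_all add: \<pi>_append)
  have "kernel ?G (presented_group R') ?f \<subseteq> N"
  proof
    fix X assume "X \<in> kernel ?G (presented_group R') ?f"
    then obtain w where X: "X = word_class R w" and "word_class R' w = word_class R' []"
      by (auto simp: kernel_def carrier_presented_group one_presented_group f)
    then have "\<pi> w = \<pi> []"
      by (intro \<pi>_cong) (simp add: word_class_eq_iff)
    moreover have "\<pi> [] = N"
      using N.rcos_const[OF G.is_group N.one_closed] by (simp add: \<pi>_def one_presented_group)
    ultimately show "X \<in> N"
      using G.rcos_self[OF _ N.subgroup_axioms, of X] X by (simp add: \<pi>_def)
  qed
  with N have "N = kernel ?G (presented_group R') ?f" by blast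
  moreover have "?f ` carrier ?G = carrier (presented_group R')"
    by (auto simp: carrier_presented_group f image_image)
  ultimately show ?thesis using FactGroup_iso by simp
qed

text \<open>The right-hand side of the relation for \<open>b\<close> stays a word, since it is empty
  in one family and a power of \<open>a\<close> in the other.\<close>

definition metacyclic_rels :: "nat \<Rightarrow> nat \<Rightarrow> nat \<Rightarrow> nat \<Rightarrow> gen word \<Rightarrow> (gen word \<times> gen word) set" where
  "metacyclic_rels p n m r w =
     {(gen_power Gen_a (p ^ n), []),
      (gen_power Gen_b (p ^ m), w),
      (commutator_word (gen_power Gen_a 1) (gen_power Gen_b 1), gen_power Gen_a (p ^ r))}"

lemma split_pres_eq: "split_pres p n m r = presented_group (metacyclic_rels p n m r [])"
  by (simp add: split_pres_def metacyclic_rels_def)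

lemma nonsplit_pres_eq:
  "nonsplit_pres p n m l r = presented_group (metacyclic_rels p n m r (gen_power Gen_a (p ^ l)))"
  by (simp add: nonsplit_pres_def metacyclic_rels_def)

lemma metacyclic_presented_group:
  fixes w :: "gen word"
  assumes p: "prime p" and r: "2 \<le> r"
    and w: "word_cong (metacyclic_rels p n m r w) w (gen_power Gen_a (p ^ l))"
  defines "R \<equiv> metacyclic_rels p n m r w"
  shows "metacyclic (presented_group R) (word_class R [(Gen_a, True)]) (word_class R [(Gen_b, True)])
    p n m l r"
proof -
  define G where "G = presented_group R"
  interpret group G unfolding G_def by (rule group_presented_group)
  define a b where "a = word_class R [(Gen_a, True)]" and "b = word_class R [(Gen_b, True)]"
  have rel: "word_class R v = word_class R v'" if "(v, v') \<in> R" for v v'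
    using that by (simp add: word_class_eq_iff word_cong.relation)
  have carr [simp]: "word_class R v \<in> carrier G" for v by (simp add: G_def)
  have [simp]: "a \<in> carrier G" "b \<in> carrier G" by (simp_all add: a_def b_def)
  have mult: "word_class R (v @ v') = word_class R v \<otimes>\<^bsub>G\<^esub> word_class R v'" for v v'
    by (simp add: G_def mult_word_class)
  have pow: "word_class R (gen_power Gen_a k) = a [^]\<^bsub>G\<^esub> k"
      "word_class R (gen_power Gen_b k) = b [^]\<^bsub>G\<^esub> k" for k
    by (simp_all add: G_def a_def b_def word_class_gen_power)
  have inv: "word_class R [(Gen_a, False)] = inv\<^bsub>G\<^esub> a" "word_class R [(Gen_b, False)] = inv\<^bsub>G\<^esub> b"
    by (simp_all add: G_def a_def b_def word_class_inverse_letter)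
  have one: "word_class R [] = \<one>\<^bsub>G\<^esub>" by (simp add: G_def one_presented_group)
  have a_power: "a [^]\<^bsub>G\<^esub> (p ^ n) = \<one>\<^bsub>G\<^esub>"
    unfolding pow[symmetric] one[symmetric] by (rule rel) (simp add: R_def metacyclic_rels_def)
  have "b [^]\<^bsub>G\<^esub> (p ^ m) = word_class R w"
    unfolding pow[symmetric] by (rule rel) (simp add: R_def metacyclic_rels_def)
  also have "\<dots> = a [^]\<^bsub>G\<^esub> (p ^ l)"
    unfolding pow[symmetric] word_class_eq_iff using w by (simp add: R_def)
  finally have b_power: "b [^]\<^bsub>G\<^esub> (p ^ m) = a [^]\<^bsub>G\<^esub> (p ^ l)" .
  have "word_class R (commutator_word (gen_power Gen_a 1) (gen_power Gen_b 1)) = a [^]\<^bsub>G\<^esub> (p ^ r)"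
    unfolding pow[symmetric] by (rule rel) (simp add: R_def metacyclic_rels_def)
  moreover have "commutator_word (gen_power Gen_a 1) (gen_power Gen_b 1)
      = [(Gen_a, False)] @ [(Gen_b, False)] @ [(Gen_a, True)] @ [(Gen_b, True)]"
    by (simp add: commutator_word_def inv_word_def gen_power_def)
  ultimately have "inv\<^bsub>G\<^esub> (b \<otimes>\<^bsub>G\<^esub> a) \<otimes>\<^bsub>G\<^esub> (a \<otimes>\<^bsub>G\<^esub> b) = a [^]\<^bsub>G\<^esub> (p ^ r)"
    by (simp only: mult inv a_def[symmetric] b_def[symmetric]) (simp add: inv_mult_group m_assoc)
  then have "a \<otimes>\<^bsub>G\<^esub> b = (b \<otimes>\<^bsub>G\<^esub> a) \<otimes>\<^bsub>G\<^esub> a [^]\<^bsub>G\<^esub> (p ^ r)"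
    by (metis \<open>a \<in> carrier G\<close> \<open>b \<in> carrier G\<close> inv_solve_left m_closed nat_pow_closed)
  then have a_mult_b: "a \<otimes>\<^bsub>G\<^esub> b = b \<otimes>\<^bsub>G\<^esub> a [^]\<^bsub>G\<^esub> (1 + p ^ r)"
    using nat_pow_mult[of a 1 "p ^ r"] by (simp add: m_assoc)
  \<comment> \<open>The smaller locale comes first: its \<open>normal_form_mult\<close> and
    \<open>inv_b_eq\<close> drive the induction below, which appends one letter at a time.\<close>
  interpret metacyclic_pair G a b p n m l r
    by unfold_locales (fact p r a_power b_power a_mult_b | simp)+
  have *: "\<exists>(j::nat) (i::int). word_class R v = b [^]\<^bsub>G\<^esub> j \<otimes>\<^bsub>G\<^esub> a [^]\<^bsub>G\<^esub> i" for v
  proof (induction v rule: rev_induct)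
    case Nil
    show ?case by (intro exI[of _ 0]) (simp add: one)
  next
    case (snoc s v)
    then obtain j :: nat and i :: int
      where v: "word_class R v = b [^]\<^bsub>G\<^esub> j \<otimes>\<^bsub>G\<^esub> a [^]\<^bsub>G\<^esub> i" by blast
    have "\<exists>(k::nat) (h::int). word_class R [s] = b [^]\<^bsub>G\<^esub> k \<otimes>\<^bsub>G\<^esub> a [^]\<^bsub>G\<^esub> h"
    proof -
      have letters: "word_class R [(Gen_a, True)] = b [^]\<^bsub>G\<^esub> (0::nat) \<otimes>\<^bsub>G\<^esub> a [^]\<^bsub>G\<^esub> (1::int)"
        "word_class R [(Gen_a, False)] = b [^]\<^bsub>G\<^esub> (0::nat) \<otimes>\<^bsub>G\<^esub> a [^]\<^bsub>G\<^esub> (-1::int)"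
        "word_class R [(Gen_b, True)] = b [^]\<^bsub>G\<^esub> (1::nat) \<otimes>\<^bsub>G\<^esub> a [^]\<^bsub>G\<^esub> (0::int)"
        "word_class R [(Gen_b, False)] = b [^]\<^bsub>G\<^esub> (p ^ (m + n) - 1) \<otimes>\<^bsub>G\<^esub> a [^]\<^bsub>G\<^esub> (0::int)"
        by (simp_all add: inv inv_b_eq int_pow_neg) (simp_all add: a_def b_def)
      obtain g e where s: "s = (g, e)" by fastforce
      show ?thesis
        unfolding s by (cases g; cases e) (simp_all only:, (rule exI, rule exI, rule letters)+)
    qed
    then obtain k :: nat and h :: int
      where s: "word_class R [s] = b [^]\<^bsub>G\<^esub> k \<otimes>\<^bsub>G\<^esub> a [^]\<^bsub>G\<^esub> h" by blast
    show ?case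
      unfolding mult v s normal_form_mult by blast
  qed
  have "metacyclic G a b p n m l r"
  proof unfold_locales
    show "carrier G \<subseteq> {b [^]\<^bsub>G\<^esub> j \<otimes>\<^bsub>G\<^esub> a [^]\<^bsub>G\<^esub> i |(j::nat) (i::int). True}"
      using * by (auto simp: G_def carrier_presented_group)
  qed
  then show ?thesis by (simp add: G_def a_def b_def)
qed

subsection \<open>The order of \<open>a\<close>\<close>

text \<open>The affine map of \<open>\<int>\<close> by which a letter acts modulo \<open>q\<close>, from the right: \<open>a\<close> translates by
  \<open>P\<close> and \<open>b\<close> is \<open>x \<mapsto> u x + c\<close>, where \<open>v\<close> is an inverse of \<open>u\<close>.\<close>

definition affine_step :: "int \<Rightarrow> int \<Rightarrow> int \<Rightarrow> int \<Rightarrow> gen \<times> bool \<Rightarrow> int \<Rightarrow> int" where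
  "affine_step P u v c s x =
     (case s of (Gen_a, e) \<Rightarrow> if e then x + P else x - P
      | (Gen_b, e) \<Rightarrow> if e then u * x + c else v * (x - c))"

lemma cong_fold_affine_step:
  "[x = y] (mod q) \<Longrightarrow> [fold (affine_step P u v c) w x = fold (affine_step P u v c) w y] (mod q)"
proof (induction w arbitrary: x y)
  case (Cons s w)
  have "[affine_step P u v c s x = affine_step P u v c s y] (mod q)"
    using Cons.prems unfolding affine_step_def
    by (auto split: prod.split gen.split intro!: cong_add cong_diff cong_mult)
  then show ?case using Cons.IH by simp
qed simp

text \<open>The invariant is pointwise congruence of the affine maps, so the action is checked on
  words directly and no group of permutations of Z/q has to be built.\<close>

lemma cong_fold_affine_step_word_cong:
  assumes uv: "[u * v = 1] (mod q)"
    and R: "\<And>w w' x. (w, w') \<in> R \<Longrightarrow>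
      [fold (affine_step P u v c) w x = fold (affine_step P u v c) w' x] (mod q)"
    and "word_cong R w w'"
  shows "[fold (affine_step P u v c) w x = fold (affine_step P u v c) w' x] (mod q)"
  using assms(3)
proof (induction arbitrary: x)
  case (cancel g e)
  have "[v * (u * x) = x] (mod q)" "[u * (v * y) = y] (mod q)" for x y
    using cong_scalar_right[OF uv, of x] cong_scalar_right[OF uv, of y] by (simp_all add: mult_ac)
  then have "[v * (u * x) = x] (mod q)" "[u * (v * (x - c)) + c = x - c + c] (mod q)" for x
    by (blast intro: cong_add cong_refl)+
  then show ?case
    by (cases g; cases e) (simp_all add: affine_step_def)
next
  case (append v1 v1' v2 v2')
  have "[fold (affine_step P u v c) v2 (fold (affine_step P u v c) v1 x)
      = fold (affine_step P u v c) v2' (fold (affine_step P u v c) v1 x)] (mod q)"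
    by (rule append.IH)
  moreover have "[fold (affine_step P u v c) v2' (fold (affine_step P u v c) v1 x)
      = fold (affine_step P u v c) v2' (fold (affine_step P u v c) v1' x)] (mod q)"
    by (intro cong_fold_affine_step append.IH)
  ultimately show ?case by (auto intro: cong_trans)
qed (auto intro: R cong_sym cong_trans)

lemma fold_affine_step_gen_power:
  "fold (affine_step P u v c) (gen_power Gen_a k) x = x + int k * P"
  "fold (affine_step P u v c) (gen_power Gen_b k) x = u ^ k * x + c * (\<Sum>i<k. u ^ i)"
proof -
  show "fold (affine_step P u v c) (gen_power Gen_a k) x = x + int k * P"
    by (induction k arbitrary: x) (simp_all add: gen_power_def affine_step_def algebra_simps)
  show "fold (affine_step P u v c) (gen_power Gen_b k) x = u ^ k * x + c * (\<Sum>i<k. u ^ i)"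
    by (induction k arbitrary: x) (simp_all add: gen_power_def affine_step_def algebra_simps)
qed

text \<open>Translation by \<open>p^k\<close> has order \<open>p^n\<close> modulo \<open>p^(n + k)\<close>, so an affine action that satisfies the
  relations shows that they do not collapse \<open>a\<close>.\<close>

lemma ord_word_class_a:
  fixes w :: "gen word" and c :: int
  assumes p: "prime p" and r: "2 \<le> r" "n + k \<le> r + m"
    and w: "w = [] \<and> l = n \<or> w = gen_power Gen_a (p ^ l)"
    and c: "[c * (\<Sum>i<p ^ m. (1 + int p ^ r) ^ i) = int p ^ (l + k)] (mod int p ^ (n + k))"
  defines "R \<equiv> metacyclic_rels p n m r w"
  shows "group.ord (presented_group R) (word_class R [(Gen_a, True)]) = p ^ n"
proof -
  interpret group "presented_group R" by (rule group_presented_group)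
  define P q where "P = int p ^ k" and "q = int p ^ (n + k)"
  \<comment> \<open>An explicit inverse of \<open>u\<close> modulo \<open>q\<close>: the hypothesis
    n + k \<le> r + m gives u^(p^m) = 1 there.\<close>
  define u v where "u = 1 + int p ^ r" and "v = u ^ (p ^ m - 1)"
  let ?f = "fold (affine_step P u v c)"
  have q: "q = int p ^ n * P" by (simp add: q_def P_def power_add)
  have "q dvd u ^ (p ^ m) - 1"
    unfolding q_def u_def prime_power_dvd_one_plus_power_minus_one_iff[OF p r(1)]
    using r(2) by (simp add: le_imp_power_dvd)
  then have u_pow: "[u ^ (p ^ m) = 1] (mod q)"
    by (simp add: cong_iff_dvd_diff)
  moreover have "u * v = u ^ (p ^ m)"
    using prime_gt_0_nat[OF p] by (simp add: v_def flip: power_Suc)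
  ultimately have uv: "[u * v = 1] (mod q)" by simp
  have a_n: "[x + int (p ^ n) * P = x] (mod q)" for x
    by (simp add: q cong_iff_dvd_diff)
  have rels: "[?f w1 x = ?f w2 x] (mod q)" if "(w1, w2) \<in> R" for w1 w2 x
  proof -
    consider "w1 = gen_power Gen_a (p ^ n)" "w2 = []"
      | "w1 = gen_power Gen_b (p ^ m)" "w2 = w"
      | "w1 = commutator_word (gen_power Gen_a 1) (gen_power Gen_b 1)" "w2 = gen_power Gen_a (p ^ r)"
      using \<open>(w1, w2) \<in> R\<close> unfolding R_def metacyclic_rels_def by blast
    then show ?thesis
    proof cases
      case 1
      then show ?thesis using a_n by (simp add: fold_affine_step_gen_power)
    next
      case 2
      \<comment> \<open>The condition on \<open>c\<close> makes b^(p^m) the translation by p^l P,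
        which is the action of a^(p^l); for l = n it is trivial modulo \<open>q\<close>.\<close>
      have "[?f w1 x = 1 * x + int p ^ (l + k)] (mod q)"
        unfolding 2 fold_affine_step_gen_power
        using c u_pow by (intro cong_add cong_mult cong_refl) (simp_all add: u_def q_def)
      moreover have "[x + int p ^ (l + k) = ?f w x] (mod q)"
        using w a_n[of x] by (auto simp: fold_affine_step_gen_power P_def power_add)
      ultimately show ?thesis unfolding 2 by (auto intro: cong_trans)
    next
      case 3
      have "commutator_word (gen_power Gen_a 1) (gen_power Gen_b 1)
          = [(Gen_a, False), (Gen_b, False), (Gen_a, True), (Gen_b, True)]"
        by (simp add: commutator_word_def inv_word_def gen_power_def)
      then have "?f w1 x = u * v * (x - P - c) + u * P + c"
        unfolding 3 by (simp add: affine_step_def algebra_simps)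
      moreover have "[u * v * (x - P - c) + u * P + c = 1 * (x - P - c) + u * P + c] (mod q)"
        using uv by (intro cong_add cong_mult cong_refl)
      moreover have "?f w2 x = 1 * (x - P - c) + u * P + c"
        unfolding 3 by (simp add: fold_affine_step_gen_power u_def algebra_simps)
      ultimately show ?thesis by simp
    qed
  qed
  define A where "A = word_class R [(Gen_a, True)]"
  have A: "A \<in> carrier (presented_group R)" by (simp add: A_def)
  have "A [^]\<^bsub>presented_group R\<^esub> i = \<one>\<^bsub>presented_group R\<^esub> \<longleftrightarrow> p ^ n dvd i" for i
  proof
    assume "A [^]\<^bsub>presented_group R\<^esub> i = \<one>\<^bsub>presented_group R\<^esub>"
    then have "word_cong R (gen_power Gen_a i) []"
      by (simp add: A_def word_class_gen_power[symmetric] one_presented_group word_class_eq_iff)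
    from cong_fold_affine_step_word_cong[OF uv rels this, of 0]
    have "q dvd int i * P"
      by (simp add: fold_affine_step_gen_power cong_iff_dvd_diff)
    moreover have "P \<noteq> 0" using prime_gt_0_nat[OF p] by (simp add: P_def)
    ultimately have "int p ^ n dvd int i" by (simp add: q)
    then show "p ^ n dvd i" by (simp flip: of_nat_power)
  next
    assume "p ^ n dvd i"
    then obtain i' where "i = p ^ n * i'" ..
    moreover have "A [^]\<^bsub>presented_group R\<^esub> (p ^ n) = \<one>\<^bsub>presented_group R\<^esub>"
      unfolding A_def word_class_gen_power[symmetric] one_presented_group word_class_eq_iff
      by (rule word_cong.relation) (simp add: R_def metacyclic_rels_def)
    ultimately show "A [^]\<^bsub>presented_group R\<^esub> i = \<one>\<^bsub>presented_group R\<^esub>"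
      using A by (simp add: nat_pow_pow[symmetric])
  qed
  then have "ord A dvd i \<longleftrightarrow> p ^ n dvd i" for i
    using pow_eq_id[OF A] by simp
  then show ?thesis
    unfolding A_def by (metis dvd_antisym dvd_refl)
qed

text \<open>The bound n - r \<le> m is essential: b^(p^m) = 1 forces a^(u^(p^m) - 1) = 1, so the
  order of \<open>a\<close> divides p^(r+m).\<close>

lemma split_ord_a:
  assumes "prime p" "2 \<le> r" "n - r \<le> m"
  defines "R \<equiv> metacyclic_rels p n m r []"
  shows "group.ord (presented_group R) (word_class R [(Gen_a, True)]) = p ^ n"
  unfolding R_def using assms(1-3)
  by (intro ord_word_class_a[of p r n 0 m _ n 0]) (auto simp: cong_iff_dvd_diff)

text \<open>With \<open>a\<close> acting as translation by 1 modulo p^n, the constant would have to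
  solve c p^m t = p^l with \<open>t\<close> prime to p, which is impossible when l < m and l < n.
  Scaling the translation and the modulus by p^(m-l) turns the right-hand side into p^m, and c =
  t^-1 works. The requirement n + k \<le> r + m then reads n - r \<le> l.\<close>

lemma nonsplit_ord_a:
  assumes p: "prime p" and r: "2 \<le> r" and l: "n - r \<le> l" "l \<le> m"
  defines "R \<equiv> metacyclic_rels p n m r (gen_power Gen_a (p ^ l))"
  shows "group.ord (presented_group R) (word_class R [(Gen_a, True)]) = p ^ n"
proof -
  define u where "u = 1 + int p ^ r"
  obtain t where t: "u ^ (p ^ m) = 1 + int p ^ (r + m) * t" and nt: "\<not> int p dvd t"
    using one_plus_prime_power_power[OF p r] unfolding u_def by blast
  have "int p ^ r * (\<Sum>i<p ^ m. u ^ i) = u ^ (p ^ m) - 1"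
    using power_diff_1_eq[of u "p ^ m"] by (simp add: u_def)
  also have "\<dots> = int p ^ r * (int p ^ m * t)"
    by (simp add: t power_add)
  finally have sum: "(\<Sum>i<p ^ m. u ^ i) = int p ^ m * t"
    using prime_gt_0_nat[OF p] by simp
  have "coprime (int p) t"
    using p nt by (intro prime_imp_coprime) simp_all
  then have "coprime t (int p ^ (n + (m - l)))"
    by (simp add: coprime_commute)
  then obtain c where c: "[t * c = 1] (mod int p ^ (n + (m - l)))"
    using cong_solve_coprime_int by blast
  have "[int p ^ m * (t * c) = int p ^ m * 1] (mod int p ^ (n + (m - l)))"
    using c by (intro cong_mult cong_refl)
  then have "[c * (\<Sum>i<p ^ m. u ^ i) = int p ^ (l + (m - l))] (mod int p ^ (n + (m - l)))"
    using l(2) by (simp add: sum mult_ac)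
  then show ?thesis
    unfolding R_def u_def using p r l by (intro ord_word_class_a[where k = "m - l" and l = l]) auto
qed

subsection \<open>The descendant\<close>

lemma metacyclic_split_pres:
  assumes "prime p" "2 \<le> r"
  shows "metacyclic (split_pres p n m r)
    (word_class (metacyclic_rels p n m r []) [(Gen_a, True)])
    (word_class (metacyclic_rels p n m r []) [(Gen_b, True)]) p n m n r"
  unfolding split_pres_eq using assms
proof (rule metacyclic_presented_group)
  show "word_cong (metacyclic_rels p n m r []) [] (gen_power Gen_a (p ^ n))"
    by (intro word_cong.sym[OF word_cong.relation]) (simp add: metacyclic_rels_def)
qed

lemma comm_group_split_pres_iff:
  assumes p: "prime p" and r: "2 \<le> r" and m: "n - r \<le> m"
  shows "comm_group (split_pres p n m r) \<longleftrightarrow> n \<le> r"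
proof -
  define R where "R = metacyclic_rels p n m r []"
  define A where "A = word_class R [(Gen_a, True)]"
  interpret metacyclic "split_pres p n m r" A "word_class R [(Gen_b, True)]" p n m n r
    unfolding A_def R_def using p r by (rule metacyclic_split_pres)
  have "ord A = p ^ n"
    using split_ord_a[OF p r m] by (simp add: A_def R_def split_pres_eq)
  then have "A [^]\<^bsub>split_pres p n m r\<^esub> (p ^ r) = \<one>\<^bsub>split_pres p n m r\<^esub> \<longleftrightarrow> p ^ n dvd p ^ r"
    by (simp add: pow_eq_id)
  also have "\<dots> \<longleftrightarrow> n \<le> r"
    using prime_gt_1_nat[OF p] by (subst dvd_power_iff) auto
  finally show ?thesis using comm_group_iff by simp
qed

lemma comm_group_cong_iso:
  assumes "G \<cong> H" "group G" "group H"
  shows "comm_group G \<longleftrightarrow> comm_group H"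
proof
  assume "comm_group G"
  then show "comm_group H"
    using assms(1) group.is_monoid[OF assms(3)] by (rule comm_group.iso_imp_comm_group)
next
  assume "comm_group H"
  then show "comm_group G"
    using group.iso_sym[OF assms(2,1)] group.is_monoid[OF assms(2)]
    by (rule comm_group.iso_imp_comm_group)
qed

text \<open>All cases at once, with s = n - r + 1. Each of n', m' is s, or it is the exponent of its
  own side of b^(p^m) = a^(p^l) when the other side is already killed by the relators with exponent
  p^s. The condition \<open>nm'\<close> keeps the order of \<open>a\<close> in the target equal to
  p^(n'), as the criterion for commutativity requires.\<close>

lemma metacyclic_descendant:
  fixes w :: "gen word"
  assumes p: "prime p" and r: "2 \<le> r" "r < n"
    and w: "w = [] \<and> l = n \<or> w = gen_power Gen_a (p ^ l)"
    and ord: "group.ord (presented_group (metacyclic_rels p n m r w))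
      (word_class (metacyclic_rels p n m r w) [(Gen_a, True)]) = p ^ n"
    and n': "n' \<le> l" "n' = n - r + 1 \<or> n' = l \<and> n' \<le> n - r + 1 \<and> n - r + 1 \<le> m"
    and m': "m' \<le> m" "m' = n - r + 1 \<or> m' = m \<and> m' \<le> n - r + 1 \<and> n - r + 1 \<le> l"
    and nm': "n' - r \<le> m'"
  defines "G \<equiv> presented_group (metacyclic_rels p n m r w)"
  shows "direct_descendant p (descendant p G) G"
    and "descendant p G \<cong> split_pres p n' m' r"
    and "comm_group (descendant p G) \<longleftrightarrow> n' \<le> r"
proof -
  define R R' where "R = metacyclic_rels p n m r w" and "R' = metacyclic_rels p n' m' r []"
  define A B where "A = word_class R [(Gen_a, True)]" and "B = word_class R [(Gen_b, True)]"
  have G: "G = presented_group R" by (simp add: G_def R_def)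
  have "word_cong R w (gen_power Gen_a (p ^ l))"
    using w
  proof
    assume "w = [] \<and> l = n"
    then show ?thesis
      by (intro word_cong.sym[OF word_cong.relation]) (simp add: R_def metacyclic_rels_def)
  qed (simp add: word_cong.refl)
  then interpret G: metacyclic G A B p n m l r
    unfolding G A_def B_def R_def using p r(1) by (intro metacyclic_presented_group)
  have ord_A: "G.ord A = p ^ n" using ord by (simp add: G A_def R_def)
  define N where "N = power_subgroup G (group_center G) p"
  define s where "s = n - r + 1"
  have N_eq: "N = generate G {A [^]\<^bsub>G\<^esub> (p ^ s), B [^]\<^bsub>G\<^esub> (p ^ s)}"
    unfolding N_def s_def using ord_A r(2) by (intro G.power_subgroup_center) simp_all
  have normal: "N \<lhd> G" unfolding N_def by (rule G.power_subgroup_center_normal)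
  interpret N: normal N G by (rule normal)
  interpret D: metacyclic "G Mod N" "N #>\<^bsub>G\<^esub> A" "N #>\<^bsub>G\<^esub> B" p n m l r
    using normal by (rule G.metacyclic_Mod)
  have D: "descendant p G = G Mod N" by (simp add: descendant_def N_def)
  have "\<not> p ^ n dvd p ^ r"
    using prime_gt_1_nat[OF p] r(2) by (subst dvd_power_iff) auto
  then have "\<not> comm_group G"
    unfolding G.comm_group_iff using G.pow_eq_id[OF G.a_closed] ord_A by simp
  then show "direct_descendant p (descendant p G) G"
    unfolding direct_descendant_def D
    using G.powerfully_nilpotent D.powerfully_nilpotent iso_refl by blast
  have pow: "word_class R (gen_power Gen_a k) = A [^]\<^bsub>G\<^esub> k"
      "word_class R (gen_power Gen_b k) = B [^]\<^bsub>G\<^esub> k" for k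
    by (simp_all add: G A_def B_def word_class_gen_power)
  have one: "word_class R [] = \<one>\<^bsub>G\<^esub>" by (simp add: G one_presented_group)

  define G' where "G' = split_pres p n' m' r"
  define A' B' where "A' = word_class R' [(Gen_a, True)]" and "B' = word_class R' [(Gen_b, True)]"
  have G': "G' = presented_group R'" by (simp add: G'_def R'_def split_pres_eq)
  interpret G': metacyclic G' A' B' p n' m' n' r
    unfolding G'_def A'_def B'_def R'_def using p r(1) by (rule metacyclic_split_pres)
  have pow': "word_class R' (gen_power Gen_a k) = A' [^]\<^bsub>G'\<^esub> k"
      "word_class R' (gen_power Gen_b k) = B' [^]\<^bsub>G'\<^esub> k" for k
    by (simp_all add: G' A'_def B'_def word_class_gen_power)
  have one': "word_class R' [] = \<one>\<^bsub>G'\<^esub>" by (simp add: G' one_presented_group)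
  have A'_one: "A' [^]\<^bsub>G'\<^esub> (p ^ k) = \<one>\<^bsub>G'\<^esub>" if "n' \<le> k" for k
    using G'.power_power_in_subgroup[OF G'.triv_subgroup, of A' p n' k] that G'.a_power by simp
  have B'_one: "B' [^]\<^bsub>G'\<^esub> (p ^ k) = \<one>\<^bsub>G'\<^esub>" if "m' \<le> k" for k
    using G'.power_power_in_subgroup[OF G'.triv_subgroup, of B' p m' k] that
      G'.b_power G'.a_power by simp
  have n'_le: "n' \<le> n" "n' \<le> s" and m'_le: "m' \<le> s"
    using n' m' r by (auto simp: s_def)

  have RR': "word_cong R' v v'" if vR: "(v, v') \<in> R" for v v'
  proof -
    \<comment> \<open>Here \<open>n' \<le> l\<close> makes the right-hand side of the relation for
      \<open>b\<close> trivial in the target; \<open>m' \<le> m\<close> does the same for the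
      left-hand side.\<close>
    have w_one: "word_class R' w = \<one>\<^bsub>G'\<^esub>"
      using w by (elim disjE conjE) (simp_all add: pow' one' A'_one[OF n'(1)])
    consider "v = gen_power Gen_a (p ^ n)" "v' = []" | "v = gen_power Gen_b (p ^ m)" "v' = w"
      | "(v, v') \<in> R'"
      using vR unfolding R_def R'_def metacyclic_rels_def by blast
    then have "word_class R' v = word_class R' v'"
    proof cases
      case 3
      then show ?thesis by (simp add: word_class_eq_iff word_cong.relation)
    qed (simp_all add: pow' one' w_one A'_one[OF n'_le(1)] B'_one[OF m'(1)])
    then show ?thesis by (simp add: word_class_eq_iff)
  qed
  interpret f: group_hom G G' "presentation_map R'"
    unfolding G G' using RR' by (rule group_hom_presentation_map)
  note f = presentation_map_word_class[where R = R and R' = R', OF RR']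
  have "N \<subseteq> kernel G G' (presentation_map R')"
    unfolding N_eq
  proof (intro G.generate_subgroup_incl f.subgroup_kernel)
    have "presentation_map R' (A [^]\<^bsub>G\<^esub> (p ^ s)) = \<one>\<^bsub>G'\<^esub>"
      using A'_one[OF n'_le(2)] by (simp add: pow[symmetric] f pow')
    moreover have "presentation_map R' (B [^]\<^bsub>G\<^esub> (p ^ s)) = \<one>\<^bsub>G'\<^esub>"
      using B'_one[OF m'_le] by (simp add: pow[symmetric] f pow')
    ultimately show "{A [^]\<^bsub>G\<^esub> (p ^ s), B [^]\<^bsub>G\<^esub> (p ^ s)} \<subseteq> kernel G G' (presentation_map R')"
      by (simp add: kernel_def)
  qed
  moreover have "N #>\<^bsub>G\<^esub> word_class R v = N #>\<^bsub>G\<^esub> word_class R v'" if vR: "(v, v') \<in> R'" for v v'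
  proof -
    have gens: "A [^]\<^bsub>G\<^esub> (p ^ s) \<in> N" "B [^]\<^bsub>G\<^esub> (p ^ s) \<in> N"
      unfolding N_eq by (auto intro: generate.incl)
    note powers = G.power_power_in_subgroup[OF N.subgroup_axioms]
    \<comment> \<open>In the second alternative a^(p^l) = b^(p^m), which lies in \<open>N\<close>
      because m \<ge> s. The argument for \<open>B_N\<close> is the mirror image.\<close>
    have A_N: "A [^]\<^bsub>G\<^esub> (p ^ n') \<in> N"
      using n'(2)
    proof
      assume "n' = l \<and> n' \<le> n - r + 1 \<and> n - r + 1 \<le> m"
      then show ?thesis
        using powers[OF G.b_closed gens(2), of m] G.b_power by (simp add: s_def)
    qed (use gens in \<open>simp add: s_def\<close>)
    have B_N: "B [^]\<^bsub>G\<^esub> (p ^ m') \<in> N"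
      using m'(2)
    proof
      assume "m' = m \<and> m' \<le> n - r + 1 \<and> n - r + 1 \<le> l"
      then show ?thesis
        using powers[OF G.a_closed gens(1), of l] G.b_power by (simp add: s_def)
    qed (use gens in \<open>simp add: s_def\<close>)
    consider "v = gen_power Gen_a (p ^ n')" "v' = []" | "v = gen_power Gen_b (p ^ m')" "v' = []"
      | "(v, v') \<in> R"
      using vR unfolding R_def R'_def metacyclic_rels_def by blast
    then show ?thesis
    proof cases
      case 3
      then have "word_class R v = word_class R v'"
        by (simp add: word_class_eq_iff word_cong.relation)
      then show ?thesis by simp
    qed (simp_all add: pow one A_N B_N N.rcos_const[OF G.is_group])
  qed
  ultimately have "G Mod N \<cong> G'"
    unfolding G G' using RR' normal[unfolded G] by (intro presented_group_Mod_iso)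
  then show "descendant p G \<cong> split_pres p n' m' r"
    by (simp add: D G'_def)
  have "comm_group (G Mod N) \<longleftrightarrow> comm_group G'"
    using \<open>G Mod N \<cong> G'\<close> D.is_group G'.is_group by (rule comm_group_cong_iso)
  also have "\<dots> \<longleftrightarrow> n' \<le> r"
    unfolding G'_def using p r(1) nm' by (rule comm_group_split_pres_iff)
  finally show "comm_group (descendant p G) \<longleftrightarrow> n' \<le> r" by (simp add: D)
qed

theorem mainTheorem3:
  fixes p :: nat
  assumes "prime p"
  shows
    "(\<forall>n m r :: nat.
        0 < n \<and> 0 < m \<and> n - r \<le> m \<and> 2 \<le> r \<and> r \<le> n - 1 \<longrightarrow>
        (let G = split_pres p n m r; D = descendant p G in
           direct_descendant p D G \<and>
           (n - r < m \<longrightarrow> D \<cong> split_pres p (n - r + 1) (n - r + 1) r) \<and>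
           (m = n - r \<longrightarrow> D \<cong> split_pres p (n - r + 1) (n - r) r) \<and>
           (comm_group D \<longleftrightarrow> n - r + 1 \<le> r)))
     \<and>
     (\<forall>n m l r :: nat.
        0 < n \<and> 0 < m \<and> 2 \<le> r \<and> r < l \<and> l \<le> n - 1 \<and> n - r \<le> l \<and> l < m \<longrightarrow>
        (let G = nonsplit_pres p n m l r; D = descendant p G in
           direct_descendant p D G \<and>
           (n - r < l \<longrightarrow>
              D \<cong> split_pres p (n - r + 1) (n - r + 1) r \<and>
              (comm_group D \<longleftrightarrow> n - r + 1 \<le> r)) \<and>
           (n - r = l \<longrightarrow>
              D \<cong> split_pres p (n - r) (n - r + 1) r \<and>
              \<not> comm_group D)))"
proof (intro conjI allI impI)
  fix n m r :: nat
  assume *: "0 < n \<and> 0 < m \<and> n - r \<le> m \<and> 2 \<le> r \<and> r \<le> n - 1"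
  \<comment> \<open>This is the minimum of m and n - r + 1: the relation b^(p^m) = 1 already beats
    the new relator exactly when m = n - r.\<close>
  define m' where "m' = (if n - r < m then n - r + 1 else n - r)"
  let ?G = "split_pres p n m r"
  have "direct_descendant p (descendant p ?G) ?G
      \<and> descendant p ?G \<cong> split_pres p (n - r + 1) m' r
      \<and> (comm_group (descendant p ?G) \<longleftrightarrow> n - r + 1 \<le> r)"
    unfolding split_pres_eq[of p n m r] using * assms
    by (intro conjI metacyclic_descendant[where l = n and n' = "n - r + 1" and m' = m'] split_ord_a)
      (auto simp: m'_def)
  then show "let G = ?G; D = descendant p G in
           direct_descendant p D G \<and>
           (n - r < m \<longrightarrow> D \<cong> split_pres p (n - r + 1) (n - r + 1) r) \<and>
           (m = n - r \<longrightarrow> D \<cong> split_pres p (n - r + 1) (n - r) r) \<and>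
           (comm_group D \<longleftrightarrow> n - r + 1 \<le> r)"
    by (auto simp: Let_def m'_def)
next
  fix n m l r :: nat
  assume *: "0 < n \<and> 0 < m \<and> 2 \<le> r \<and> r < l \<and> l \<le> n - 1 \<and> n - r \<le> l \<and> l < m"
  define n' where "n' = (if n - r < l then n - r + 1 else n - r)"
  let ?G = "nonsplit_pres p n m l r"
  have "direct_descendant p (descendant p ?G) ?G
      \<and> descendant p ?G \<cong> split_pres p n' (n - r + 1) r
      \<and> (comm_group (descendant p ?G) \<longleftrightarrow> n' \<le> r)"
    unfolding nonsplit_pres_eq using * assms
    by (intro conjI metacyclic_descendant[where l = l and n' = n' and m' = "n - r + 1"]
        nonsplit_ord_a) (auto simp: n'_def)
  \<comment> \<open>When n - r = l, the value n' = l exceeds r, so the criterion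
    \<open>n' \<le> r\<close> fails and the descendant is not abelian.\<close>
  then show "let G = ?G; D = descendant p G in
           direct_descendant p D G \<and>
           (n - r < l \<longrightarrow>
              D \<cong> split_pres p (n - r + 1) (n - r + 1) r \<and>
              (comm_group D \<longleftrightarrow> n - r + 1 \<le> r)) \<and>
           (n - r = l \<longrightarrow>
              D \<cong> split_pres p (n - r) (n - r + 1) r \<and>
              \<not> comm_group D)"
    using * by (auto simp: Let_def n'_def)
qed

end
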